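(* Let $G$ be a finite group, $\mathcal C\subset G$ a conjugacy class, $r\in\mathcal C$ with centraliser $C_G$, and $\pi$ an irreducible complex representation of $C_G$. Let $W$ be a right $D^\vee(G)$-comodule, with coaction written $\Delta_Rw=\sum_{g\in G}g\triangleright w\otimes\delta_g\otimes|w|$, such that the $H$-comodule $V_{r,\pi}$ is contained in the pushout of $W$ to an $H$-comodule. Then the composition $$E\hookrightarrow E^W\xrightarrow{\ \mathrm{av}\ }E'$$ is, under the identifications $E\cong\mathbb C(G/C_G)\otimes V_{r,\pi}$ and $E'\cong\mathbb CG\otimes W$, given by the following embedding of left $D^\vee(G)$-comodules: $$f\otimes v\mapsto\sum_{c\in\mathcal C}c^{-1}\otimes\Big(\int_{\mathbb C(G/C_G)}(f\otimes v)_{cov}^{(1)}\,\delta_{q_c}\Big)(f\otimes v)_{cov}^{(2)}=\frac{|C_G|}{|G|}\sum_{c\in\mathcal C}f(q_c)\,c^{-1}\otimes q_c\triangleright v,$$ for $f\otimes v\in\mathbb C(G/C_G)\otimes V_{r,\pi}$ and with result in $\mathbb CG\otimes W$.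
   Context: $\mathbb C(G)$ denotes functions on $G$ with basis $\delta_g$, $\mathbb CG$ the group algebra, $e$ the identity. $D^\vee(G)$ is the Hopf algebra on $\mathbb C(G)\otimes\mathbb CG$ with tensor product algebra and counit and $\Delta(\delta_g\otimes h)=\sum_{f\in G}\delta_f\otimes f^{-1}ghg^{-1}f\otimes\delta_{f^{-1}g}\otimes h$, $S(\delta_g\otimes h)=\delta_{g^{-1}}\otimes gh^{-1}g^{-1}$. Right $D^\vee(G)$-comodules are the same as $G$-crossed modules ($G$-graded spaces with a left $G$-action such that $|g\triangleright w|=g|w|g^{-1}$) via the displayed coaction formula ($w$ homogeneous of degree $|w|$). $H=\mathbb C(C_G)\otimes\mathbb CG$ is the quotient Hopf algebra of $D^\vee(G)$ by $p:\delta_g\otimes h\mapsto\delta_g\otimes h$ if $g\in C_G$, else $0$. Pushout of a comodule means composing the coaction with the Hopf algebra surjection. $V_{r,\pi}=V_\pi$ with right $H$-coaction $v\mapsto\sum_{g\in C_G}\pi(g)v\otimes\delta_g\otimes r$. $q:\mathcal C\to G$ is a fixed map with $q_crq_c^{-1}=c$, $q_r=e$. $\mathbb C(G/C_G)\subset\mathbb C(G)$ is the algebra of functions invariant under right translation by $C_G$, with basis written $\delta_{q_c}$ ($c\in\mathcal C$), identified in $\mathbb C(G)$ with $\sum_{n\in C_G}\delta_{q_cn}$; $f(q_c)$ is the value of $f$ on the coset $q_cC_G$. $\int_{\mathbb C(G/C_G)}f=\frac{|C_G|}{|G|}\sum_{c\in\mathcal C}f(q_c)$. For $\delta_{q_c}\otimes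 w\in\mathbb C(G/C_G)\otimes W$, $(\delta_{q_c}\otimes w)_{cov}=\delta_{q_c}\otimes q_c\triangleright w$, extended linearly, and $x^{(1)}\otimes x^{(2)}$ denotes the tensor factors of $x$. $E=(D^\vee(G)\otimes V_{r,\pi})^H$ and $E^W=(D^\vee(G)\otimes W)^H$ are invariants under the tensor product right $H$-coaction, $D^\vee(G)$ having coaction $(\mathrm{id}\otimes p)\Delta$ and $W$ its pushout; $E\hookrightarrow E^W$ is induced by $V_{r,\pi}\subseteq W$. $E'=(D^\vee(G)\otimes W)^{\mathbb C(G)}$ are the invariants for the pushouts along $\mathrm{id}\otimes\epsilon:D^\vee(G)\to\mathbb C(G)$, $\delta_g\otimes h\mapsto\delta_g$ (so $W$ has coaction $w\mapsto\sum_gg\triangleright w\otimes\delta_g$). $E$, $E^W$ and $E'$ are left $D^\vee(G)$-comodules by the coproduct of $D^\vee(G)$ on the first factor. Identifications: $\mathbb C(G/C_G)\otimes V_{r,\pi}\cong E$ by $\delta_{q_c}\otimes v\mapsto\sum_{g\in C_G}\delta_{q_cg^{-1}}\otimes r^{-1}\otimes g\triangleright v$; $\mathbb CG\otimes W\cong E'$ by $g\otimes w\mapsto\sum_{f\in G}\delta_{f^{-1}}\otimes fgf^{-1}\otimes f\triangleright w$. The resulting left coactions are $\delta_{q_c}\otimes v\mapsto\sum_{f\in G}\delta_f\otimes f^{-1}c^{-1}f\otimes\delta_{q_{f^{-1}cf}}\otimes\zeta_c(f^{-1})\triangleright v$ with $\zeta_c(g)=q_{gcg^{-1}}^{-1}gq_c\in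 C_G$, and $g\otimes w\mapsto\sum_{f\in G}\delta_f\otimes f^{-1}gf\otimes f^{-1}gf\otimes f^{-1}\triangleright w$. The averaging map is $\mathrm{av}:D^\vee(G)\otimes W\to E'$, $\mathrm{av}(x\otimes w)=x^{1'}\otimes w^{1'}\int w^{2'}S^2(x^{2'})$, where $x^{1'}\otimes x^{2'}$, $w^{1'}\otimes w^{2'}$ are the right $\mathbb C(G)$-coactions and $\int f=\frac1{|G|}\sum_gf(g)$ on $\mathbb C(G)$; explicitly $\mathrm{av}((\delta_g\otimes h)\otimes w)=\frac1{|G|}\sum_{k\in G}\delta_{gk^{-1}}\otimes khk^{-1}\otimes k\triangleright w$. *)

theory Defs
  imports Complex_Main "HOL-Algebra.Group_Action" "HOL-Library.Function_Algebras"
begin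

text \<open>
  Conventions. A vector space with a fixed finite basis \<open>B\<close> is represented by the functions
  \<open>'b \<Rightarrow> complex\<close> vanishing outside \<open>B\<close>; more generally its tensor product with a complex vector
  space \<open>(W, s)\<close> is represented, irrespective of the order of the two factors, by the functions
  \<open>'b \<Rightarrow> 'w\<close> vanishing outside \<open>B\<close>. The tensor \<open>b \<otimes> w\<close> with \<open>b \<in> B\<close> is \<open>single b w\<close>, and
  \<open>single b 1\<close> is the basis vector \<open>b\<close> itself. Thus \<open>\<delta>\<^sub>g \<otimes> h\<close> in the tensor product of the function
  algebra and the group algebra of \<open>G\<close> is \<open>single (g, h) 1\<close>. Sums and products of functions are the
  pointwise ones of \<open>HOL-Library.Function_Algebras\<close>.
\<close>

definition single :: "'b \<Rightarrow> 'w \<Rightarrow> 'b \<Rightarrow> 'w::zero" where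
  "single b w = (\<lambda>b'. if b' = b then w else 0)"

definition supported :: "'b set \<Rightarrow> ('b \<Rightarrow> 'w::zero) set" where
  "supported B = {x. \<forall>b. b \<notin> B \<longrightarrow> x b = 0}"

definition fscale :: "(complex \<Rightarrow> 'w \<Rightarrow> 'w) \<Rightarrow> complex \<Rightarrow> ('b \<Rightarrow> 'w) \<Rightarrow> 'b \<Rightarrow> 'w" where
  "fscale s a x = (\<lambda>b. s a (x b))"

definition pure_tensor :: "(complex \<Rightarrow> 'w \<Rightarrow> 'w) \<Rightarrow> ('b \<Rightarrow> complex) \<Rightarrow> 'w \<Rightarrow> 'b \<Rightarrow> 'w" where
  "pure_tensor s a w = (\<lambda>b. s (a b) w)"

text \<open>\<open>T \<otimes> id\<close> (or \<open>id \<otimes> T\<close>) on the tensor product of the space with basis \<open>B\<close> and \<open>(W, s)\<close>, for a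
  linear map \<open>T\<close> of the first of these spaces.\<close>
definition tensor_id ::
  "(complex \<Rightarrow> 'w \<Rightarrow> 'w::ab_group_add) \<Rightarrow> 'b set \<Rightarrow> (('b \<Rightarrow> complex) \<Rightarrow> 'c \<Rightarrow> complex) \<Rightarrow> ('b \<Rightarrow> 'w) \<Rightarrow> 'c \<Rightarrow> 'w"
  where "tensor_id s B T x = (\<Sum>b\<in>B. pure_tensor s (T (single b 1)) (x b))"

text \<open>\<open>id \<otimes> T\<close> for a linear map \<open>T\<close> between spaces of functions, with an inert basis index on the
  left.\<close>
definition id_tensor :: "(('m \<Rightarrow> 'v) \<Rightarrow> 'n \<Rightarrow> 'w) \<Rightarrow> ('b \<times> 'm \<Rightarrow> 'v) \<Rightarrow> 'b \<times> 'n \<Rightarrow> 'w" where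
  "id_tensor T y = (\<lambda>(b, n). T (\<lambda>m. y (b, m)) n)"

definition basis_tensor :: "'b \<Rightarrow> ('m \<Rightarrow> 'w) \<Rightarrow> 'b \<times> 'm \<Rightarrow> 'w::zero" where
  "basis_tensor b y = (\<lambda>(b', m). if b' = b then y m else 0)"

text \<open>Only the structure maps are recorded; they are meant to be linear (bilinear for \<open>hmult\<close>) on the
  functions vanishing outside \<open>hbasis\<close>.\<close>
record 'b hopf =
  hbasis :: "'b set"
  hmult :: "('b \<Rightarrow> complex) \<Rightarrow> ('b \<Rightarrow> complex) \<Rightarrow> 'b \<Rightarrow> complex"
  hunit :: "'b \<Rightarrow> complex"
  hcomult :: "('b \<Rightarrow> complex) \<Rightarrow> 'b \<times> 'b \<Rightarrow> complex"
  hcounit :: "('b \<Rightarrow> complex) \<Rightarrow> complex"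
  hantipode :: "('b \<Rightarrow> complex) \<Rightarrow> 'b \<Rightarrow> complex"

text \<open>A right coaction \<open>\<rho> : W \<rightarrow> W \<otimes> A\<close> on the whole space \<open>(W, s)\<close>. In the coassociativity law the
  index \<open>b\<close> refers to the first and \<open>b'\<close> to the second copy of \<open>A\<close> in \<open>W \<otimes> A \<otimes> A\<close>.\<close>
definition right_comodule ::
  "'b hopf \<Rightarrow> (complex \<Rightarrow> 'w \<Rightarrow> 'w::ab_group_add) \<Rightarrow> ('w \<Rightarrow> 'b \<Rightarrow> 'w) \<Rightarrow> bool" where
  "right_comodule A s \<rho> \<longleftrightarrow>
     Vector_Spaces.linear s (fscale s) \<rho> \<and>
     (\<forall>w. \<rho> w \<in> supported (hbasis A)) \<and>
     (\<forall>w. (\<lambda>(b, b'). \<rho> (\<rho> w b') b) = tensor_id s (hbasis A) (hcomult A) (\<rho> w)) \<and>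
     (\<forall>w. (\<Sum>b\<in>hbasis A. s (hcounit A (single b 1)) (\<rho> w b)) = w)"

definition pushout ::
  "'b hopf \<Rightarrow> (complex \<Rightarrow> 'w \<Rightarrow> 'w::ab_group_add) \<Rightarrow> (('b \<Rightarrow> complex) \<Rightarrow> 'c \<Rightarrow> complex) \<Rightarrow> ('w \<Rightarrow> 'b \<Rightarrow> 'w) \<Rightarrow> 'w \<Rightarrow> 'c \<Rightarrow> 'w"
  where "pushout A s T \<rho> w = tensor_id s (hbasis A) T (\<rho> w)"

text \<open>Tensor product of right \<open>A\<close>-comodules, \<open>x \<otimes> w \<mapsto> x\<^sup>1 \<otimes> w\<^sup>1 \<otimes> x\<^sup>2 w\<^sup>2\<close>, where the first comodule has
  basis \<open>B\<close>.\<close>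
definition tensor_coaction ::
  "'c hopf \<Rightarrow> (complex \<Rightarrow> 'w \<Rightarrow> 'w::ab_group_add) \<Rightarrow> 'b set \<Rightarrow> (('b \<Rightarrow> complex) \<Rightarrow> 'b \<times> 'c \<Rightarrow> complex) \<Rightarrow>
     ('w \<Rightarrow> 'c \<Rightarrow> 'w) \<Rightarrow> ('b \<Rightarrow> 'w) \<Rightarrow> 'b \<times> 'c \<Rightarrow> 'w"
  where "tensor_coaction A s B \<sigma> \<rho> x =
    (\<Sum>b\<in>B. \<Sum>k\<in>hbasis A. \<Sum>l\<in>hbasis A.
       (\<lambda>(b', j). s (\<sigma> (single b 1) (b', k) * hmult A (single k 1) (single l 1) j) (\<rho> (x b) l)))"

definition invariants ::
  "'c hopf \<Rightarrow> (complex \<Rightarrow> 'w \<Rightarrow> 'w::ab_group_add) \<Rightarrow> 'b set \<Rightarrow> (('b \<Rightarrow> 'w) \<Rightarrow> 'b \<times> 'c \<Rightarrow> 'w) \<Rightarrow> ('b \<Rightarrow> 'w) set"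
  where "invariants A s B R = {x \<in> supported B. R x = (\<lambda>(b, k). s (hunit A k) (x b))}"

text \<open>A left coaction \<open>L : M \<rightarrow> A \<otimes> M\<close> on a space \<open>M\<close> of functions \<open>'m \<Rightarrow> 'v\<close>.\<close>
definition left_comodule ::
  "'b hopf \<Rightarrow> (complex \<Rightarrow> 'v \<Rightarrow> 'v::ab_group_add) \<Rightarrow> ('m \<Rightarrow> 'v) set \<Rightarrow> (('m \<Rightarrow> 'v) \<Rightarrow> 'b \<times> 'm \<Rightarrow> 'v) \<Rightarrow> bool"
  where "left_comodule A s M L \<longleftrightarrow>
     vector_space s \<and> module.subspace (fscale s) M \<and>
     (\<forall>x\<in>M. \<forall>y\<in>M. L (x + y) = L x + L y) \<and>
     (\<forall>a. \<forall>x\<in>M. L (fscale s a x) = fscale s a (L x)) \<and>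
     (\<forall>x\<in>M. \<forall>b. (\<lambda>m. L x (b, m)) \<in> M) \<and>
     (\<forall>x\<in>M. \<forall>b m. b \<notin> hbasis A \<longrightarrow> L x (b, m) = 0) \<and>
     (\<forall>x\<in>M. \<forall>b b' m. L (\<lambda>m'. L x (b, m')) (b', m) =
        tensor_id s (hbasis A) (hcomult A) (\<lambda>b''. L x (b'', m)) (b, b')) \<and>
     (\<forall>x\<in>M. \<forall>m. (\<Sum>b\<in>hbasis A. s (hcounit A (single b 1)) (L x (b, m))) = x m)"

definition left_comodule_hom ::
  "'b hopf \<Rightarrow> (complex \<Rightarrow> 'v \<Rightarrow> 'v::ab_group_add) \<Rightarrow> ('m \<Rightarrow> 'v) set \<Rightarrow> (('m \<Rightarrow> 'v) \<Rightarrow> 'b \<times> 'm \<Rightarrow> 'v) \<Rightarrow>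
     (complex \<Rightarrow> 'w \<Rightarrow> 'w::ab_group_add) \<Rightarrow> ('n \<Rightarrow> 'w) set \<Rightarrow> (('n \<Rightarrow> 'w) \<Rightarrow> 'b \<times> 'n \<Rightarrow> 'w) \<Rightarrow>
     (('m \<Rightarrow> 'v) \<Rightarrow> 'n \<Rightarrow> 'w) \<Rightarrow> bool"
  where "left_comodule_hom A s M L s' M' L' T \<longleftrightarrow>
     left_comodule A s M L \<and> left_comodule A s' M' L' \<and>
     T ` M \<subseteq> M' \<and>
     (\<forall>x\<in>M. \<forall>y\<in>M. T (x + y) = T x + T y) \<and>
     (\<forall>a. \<forall>x\<in>M. T (fscale s a x) = fscale s' a (T x)) \<and>
     (\<forall>x\<in>M. id_tensor T (L x) = L' (T x))"

definition left_comodule_embedding where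
  "left_comodule_embedding A s M L s' M' L' T \<longleftrightarrow>
     left_comodule_hom A s M L s' M' L' T \<and> inj_on T M"

definition left_comodule_iso where
  "left_comodule_iso A s M L s' M' L' T \<longleftrightarrow>
     left_comodule_hom A s M L s' M' L' T \<and> bij_betw T M M'"

definition conj_by :: "('g, 'z) monoid_scheme \<Rightarrow> 'g \<Rightarrow> 'g \<Rightarrow> 'g" where
  "conj_by G g h = g \<otimes>\<^bsub>G\<^esub> h \<otimes>\<^bsub>G\<^esub> inv\<^bsub>G\<^esub> g"

definition conj_classes :: "('g, 'z) monoid_scheme \<Rightarrow> 'g set set" where
  "conj_classes G = orbits G (carrier G) (conj_by G)"

definition centralizer :: "('g, 'z) monoid_scheme \<Rightarrow> 'g \<Rightarrow> 'g set" where
  "centralizer G r = {g \<in> carrier G. g \<otimes>\<^bsub>G\<^esub> r = r \<otimes>\<^bsub>G\<^esub> g}"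

definition representation ::
  "('g, 'z) monoid_scheme \<Rightarrow> 'g set \<Rightarrow> (complex \<Rightarrow> 'v \<Rightarrow> 'v::ab_group_add) \<Rightarrow> ('g \<Rightarrow> 'v \<Rightarrow> 'v) \<Rightarrow> bool" where
  "representation G K s \<pi> \<longleftrightarrow>
     (\<forall>g\<in>K. Vector_Spaces.linear s s (\<pi> g)) \<and>
     (\<forall>v. \<pi> \<one>\<^bsub>G\<^esub> v = v) \<and>
     (\<forall>g\<in>K. \<forall>h\<in>K. \<forall>v. \<pi> (g \<otimes>\<^bsub>G\<^esub> h) v = \<pi> g (\<pi> h v))"

definition irreducible_representation ::
  "('g, 'z) monoid_scheme \<Rightarrow> 'g set \<Rightarrow> (complex \<Rightarrow> 'v \<Rightarrow> 'v::ab_group_add) \<Rightarrow> ('g \<Rightarrow> 'v \<Rightarrow> 'v) \<Rightarrow> bool" where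
  "irreducible_representation G K s \<pi> \<longleftrightarrow>
     representation G K s \<pi> \<and> (\<exists>v::'v. v \<noteq> 0) \<and>
     (\<forall>U. module.subspace s U \<and> (\<forall>g\<in>K. \<pi> g ` U \<subseteq> U) \<longrightarrow> U = {0} \<or> U = UNIV)"

text \<open>\<open>W\<^sub>d = gr d\<close> is the space of homogeneous elements of degree \<open>d\<close>; the last clause is
  \<open>|g \<triangleright> w| = g|w|g\<^sup>-\<^sup>1\<close>.\<close>
definition crossed_module ::
  "('g, 'z) monoid_scheme \<Rightarrow> (complex \<Rightarrow> 'w \<Rightarrow> 'w::ab_group_add) \<Rightarrow> ('g \<Rightarrow> 'w \<Rightarrow> 'w) \<Rightarrow> ('g \<Rightarrow> 'w set) \<Rightarrow> bool" where
  "crossed_module G s act gr \<longleftrightarrow>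
     representation G (carrier G) s act \<and>
     (\<forall>d\<in>carrier G. module.subspace s (gr d)) \<and>
     (\<forall>w. \<exists>!u. u \<in> supported (carrier G) \<and> (\<forall>d\<in>carrier G. u d \<in> gr d) \<and> w = (\<Sum>d\<in>carrier G. u d)) \<and>
     (\<forall>g\<in>carrier G. \<forall>d\<in>carrier G. \<forall>w\<in>gr d. act g w \<in> gr (conj_by G g d))"

text \<open>Function algebra of \<open>K\<close> tensored with the group algebra of \<open>G\<close>, for a subgroup \<open>K\<close> of \<open>G\<close>. For
  \<open>K = G\<close> this is the dual of the quantum double; for general \<open>K\<close> it is the quotient of that Hopf
  algebra by the map \<open>restrict_fun K\<close> below, which amounts to restricting every group element
  indexing a \<open>\<delta>\<close> in the structure maps to \<open>K\<close>.\<close>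
definition double_quotient :: "('g, 'z) monoid_scheme \<Rightarrow> 'g set \<Rightarrow> ('g \<times> 'g) hopf" where
  "double_quotient G K =
    \<lparr> hbasis = K \<times> carrier G,
      hmult = (\<lambda>a b. \<Sum>g\<in>K. \<Sum>h\<in>carrier G. \<Sum>h'\<in>carrier G. single (g, h \<otimes>\<^bsub>G\<^esub> h') (a (g, h) * b (g, h'))),
      hunit = (\<Sum>g\<in>K. single (g, \<one>\<^bsub>G\<^esub>) 1),
      hcomult = (\<lambda>a. \<Sum>g\<in>K. \<Sum>h\<in>carrier G. \<Sum>f\<in>K.
        single ((f, conj_by G (inv\<^bsub>G\<^esub> f \<otimes>\<^bsub>G\<^esub> g) h), (inv\<^bsub>G\<^esub> f \<otimes>\<^bsub>G\<^esub> g, h)) (a (g, h))),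
      hcounit = (\<lambda>a. \<Sum>h\<in>carrier G. a (\<one>\<^bsub>G\<^esub>, h)),
      hantipode = (\<lambda>a. \<Sum>g\<in>K. \<Sum>h\<in>carrier G. single (inv\<^bsub>G\<^esub> g, conj_by G g (inv\<^bsub>G\<^esub> h)) (a (g, h))) \<rparr>"

definition dual_double :: "('g, 'z) monoid_scheme \<Rightarrow> ('g \<times> 'g) hopf" where
  "dual_double G = double_quotient G (carrier G)"

definition restrict_fun :: "'g set \<Rightarrow> ('g \<times> 'g \<Rightarrow> complex) \<Rightarrow> 'g \<times> 'g \<Rightarrow> complex" where
  "restrict_fun K a = (\<lambda>(g, h). if g \<in> K then a (g, h) else 0)"

definition fun_hopf :: "('g, 'z) monoid_scheme \<Rightarrow> 'g hopf" where
  "fun_hopf G =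
    \<lparr> hbasis = carrier G,
      hmult = (\<lambda>a b. a * b),
      hunit = (\<Sum>g\<in>carrier G. single g 1),
      hcomult = (\<lambda>a. \<Sum>g\<in>carrier G. \<Sum>f\<in>carrier G. single (f, inv\<^bsub>G\<^esub> f \<otimes>\<^bsub>G\<^esub> g) (a g)),
      hcounit = (\<lambda>a. a \<one>\<^bsub>G\<^esub>),
      hantipode = (\<lambda>a. \<Sum>g\<in>carrier G. single (inv\<^bsub>G\<^esub> g) (a g)) \<rparr>"

definition fun_integral :: "('g, 'z) monoid_scheme \<Rightarrow> ('g \<Rightarrow> complex) \<Rightarrow> complex" where
  "fun_integral G f = (1 / of_nat (card (carrier G))) * (\<Sum>g\<in>carrier G. f g)"

text \<open>\<open>id \<otimes> \<epsilon>\<close> from the dual of the double to the functions on \<open>G\<close>.\<close>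
definition to_fun :: "('g, 'z) monoid_scheme \<Rightarrow> ('g \<times> 'g \<Rightarrow> complex) \<Rightarrow> 'g \<Rightarrow> complex" where
  "to_fun G a = (\<Sum>g\<in>carrier G. \<Sum>h\<in>carrier G. single g (a (g, h)))"

definition V_coaction ::
  "('g, 'z) monoid_scheme \<Rightarrow> 'g \<Rightarrow> ('g \<Rightarrow> 'v \<Rightarrow> 'v::ab_group_add) \<Rightarrow> 'v \<Rightarrow> 'g \<times> 'g \<Rightarrow> 'v" where
  "V_coaction G r \<pi> v = (\<Sum>g\<in>centralizer G r. single (g, r) (\<pi> g v))"

definition H_pushout ::
  "('g, 'z) monoid_scheme \<Rightarrow> 'g \<Rightarrow> (complex \<Rightarrow> 'w \<Rightarrow> 'w::ab_group_add) \<Rightarrow> ('w \<Rightarrow> 'g \<times> 'g \<Rightarrow> 'w) \<Rightarrow> 'w \<Rightarrow> 'g \<times> 'g \<Rightarrow> 'w"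
  where "H_pushout G r s \<rho> = pushout (dual_double G) s (restrict_fun (centralizer G r)) \<rho>"

definition fun_pushout ::
  "('g, 'z) monoid_scheme \<Rightarrow> (complex \<Rightarrow> 'w \<Rightarrow> 'w::ab_group_add) \<Rightarrow> ('w \<Rightarrow> 'g \<times> 'g \<Rightarrow> 'w) \<Rightarrow> 'w \<Rightarrow> 'g \<Rightarrow> 'w"
  where "fun_pushout G s \<rho> = pushout (dual_double G) s (to_fun G) \<rho>"

text \<open>For a Hopf algebra map \<open>T\<close> this is the right coaction \<open>(id \<otimes> T)\<Delta>\<close> on the dual of the double.\<close>
definition D_coaction ::
  "('g, 'z) monoid_scheme \<Rightarrow> (('g \<times> 'g \<Rightarrow> complex) \<Rightarrow> 'c \<Rightarrow> complex) \<Rightarrow>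
     ('g \<times> 'g \<Rightarrow> complex) \<Rightarrow> ('g \<times> 'g) \<times> 'c \<Rightarrow> complex" where
  "D_coaction G T a = id_tensor T (hcomult (dual_double G) a)"

text \<open>\<open>(D \<otimes> U)\<^sup>H\<close> for a right \<open>H\<close>-comodule \<open>U\<close> with coaction \<open>\<rho>\<close>.\<close>
definition H_invariants ::
  "('g, 'z) monoid_scheme \<Rightarrow> 'g \<Rightarrow> (complex \<Rightarrow> 'u \<Rightarrow> 'u::ab_group_add) \<Rightarrow> ('u \<Rightarrow> 'g \<times> 'g \<Rightarrow> 'u) \<Rightarrow> ('g \<times> 'g \<Rightarrow> 'u) set"
  where "H_invariants G r s \<rho> =
    (let H = double_quotient G (centralizer G r); B = hbasis (dual_double G) in
     invariants H s B (tensor_coaction H s B (D_coaction G (restrict_fun (centralizer G r))) \<rho>))"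

definition E_V ::
  "('g, 'z) monoid_scheme \<Rightarrow> 'g \<Rightarrow> (complex \<Rightarrow> 'v \<Rightarrow> 'v::ab_group_add) \<Rightarrow> ('g \<Rightarrow> 'v \<Rightarrow> 'v) \<Rightarrow> ('g \<times> 'g \<Rightarrow> 'v) set"
  where "E_V G r s \<pi> = H_invariants G r s (V_coaction G r \<pi>)"

definition E_W ::
  "('g, 'z) monoid_scheme \<Rightarrow> 'g \<Rightarrow> (complex \<Rightarrow> 'w \<Rightarrow> 'w::ab_group_add) \<Rightarrow> ('w \<Rightarrow> 'g \<times> 'g \<Rightarrow> 'w) \<Rightarrow> ('g \<times> 'g \<Rightarrow> 'w) set"
  where "E_W G r s \<rho> = H_invariants G r s (H_pushout G r s \<rho>)"

definition E' ::
  "('g, 'z) monoid_scheme \<Rightarrow> (complex \<Rightarrow> 'w \<Rightarrow> 'w::ab_group_add) \<Rightarrow> ('w \<Rightarrow> 'g \<times> 'g \<Rightarrow> 'w) \<Rightarrow> ('g \<times> 'g \<Rightarrow> 'w) set"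
  where "E' G s \<rho> =
    (let B = hbasis (dual_double G) in
     invariants (fun_hopf G) s B
       (tensor_coaction (fun_hopf G) s B (D_coaction G (to_fun G)) (fun_pushout G s \<rho>)))"

text \<open>\<open>\<Delta> \<otimes> id\<close>, which restricts to the left coaction on each of \<open>E_V\<close>, \<open>E_W\<close> and \<open>E'\<close>.\<close>
definition comult_first ::
  "('g, 'z) monoid_scheme \<Rightarrow> (complex \<Rightarrow> 'w \<Rightarrow> 'w::ab_group_add) \<Rightarrow>
     ('g \<times> 'g \<Rightarrow> 'w) \<Rightarrow> ('g \<times> 'g) \<times> ('g \<times> 'g) \<Rightarrow> 'w" where
  "comult_first G s x = tensor_id s (hbasis (dual_double G)) (hcomult (dual_double G)) x"

text \<open>\<open>av (x \<otimes> w) = x\<^sup>1 \<otimes> w\<^sup>1 \<integral> w\<^sup>2 S\<^sup>2(x\<^sup>2)\<close>, in terms of the right coactions of the functions on \<open>G\<close>.\<close>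
definition av ::
  "('g, 'z) monoid_scheme \<Rightarrow> (complex \<Rightarrow> 'w \<Rightarrow> 'w::ab_group_add) \<Rightarrow> ('w \<Rightarrow> 'g \<times> 'g \<Rightarrow> 'w) \<Rightarrow>
     ('g \<times> 'g \<Rightarrow> 'w) \<Rightarrow> 'g \<times> 'g \<Rightarrow> 'w" where
  "av G s \<rho> x =
    (let F = fun_hopf G in
     \<Sum>b\<in>hbasis (dual_double G). \<Sum>k\<in>hbasis F. \<Sum>l\<in>hbasis F.
       (\<lambda>b'. s (D_coaction G (to_fun G) (single b 1) (b', k) *
                fun_integral G (hmult F (single l 1) (hantipode F (hantipode F (single k 1)))))
              (fun_pushout G s \<rho> (x b) l)))"

text \<open>Functions on \<open>G\<close> with values in \<open>'v\<close> that are invariant under right translation by \<open>K\<close>: the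
  tensor product of the functions on \<open>G/K\<close> with \<open>'v\<close>, and for complex values the functions on
  \<open>G/K\<close> themselves.\<close>
definition coset_functions :: "('g, 'z) monoid_scheme \<Rightarrow> 'g set \<Rightarrow> ('g \<Rightarrow> 'v::zero) set" where
  "coset_functions G K =
    {\<phi> \<in> supported (carrier G). \<forall>g\<in>carrier G. \<forall>n\<in>K. \<phi> (g \<otimes>\<^bsub>G\<^esub> n) = \<phi> g}"

text \<open>\<open>\<delta>\<^bsub>gK\<^esub> \<otimes> v\<close>, in particular \<open>\<delta>\<^bsub>gK\<^esub>\<close> for \<open>v = 1\<close>. An element \<open>\<phi>\<close> of
  \<open>coset_functions G (centralizer G r)\<close> is the sum of the \<open>\<delta>\<close> at \<open>q\<^sub>c\<close> tensored with \<open>\<phi> (q\<^sub>c)\<close>, over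
  \<open>c\<close> in the conjugacy class of \<open>r\<close>; the linear maps below are given on these summands.\<close>
definition coset_delta :: "('g, 'z) monoid_scheme \<Rightarrow> 'g set \<Rightarrow> 'g \<Rightarrow> 'v \<Rightarrow> 'g \<Rightarrow> 'v::comm_monoid_add" where
  "coset_delta G K g v = (\<Sum>n\<in>K. single (g \<otimes>\<^bsub>G\<^esub> n) v)"

definition coset_integral ::
  "('g, 'z) monoid_scheme \<Rightarrow> 'g set \<Rightarrow> 'g \<Rightarrow> ('g \<Rightarrow> 'g) \<Rightarrow> ('g \<Rightarrow> complex) \<Rightarrow> complex" where
  "coset_integral G C r q f =
    of_nat (card (centralizer G r)) / of_nat (card (carrier G)) * (\<Sum>c\<in>C. f (q c))"

definition E_V_iso ::
  "('g, 'z) monoid_scheme \<Rightarrow> 'g set \<Rightarrow> 'g \<Rightarrow> ('g \<Rightarrow> 'g) \<Rightarrow> ('g \<Rightarrow> 'v \<Rightarrow> 'v::ab_group_add) \<Rightarrow>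
     ('g \<Rightarrow> 'v) \<Rightarrow> 'g \<times> 'g \<Rightarrow> 'v" where
  "E_V_iso G C r q \<pi> \<phi> =
    (\<Sum>c\<in>C. \<Sum>g\<in>centralizer G r. single (q c \<otimes>\<^bsub>G\<^esub> inv\<^bsub>G\<^esub> g, inv\<^bsub>G\<^esub> r) (\<pi> g (\<phi> (q c))))"

definition E'_iso ::
  "('g, 'z) monoid_scheme \<Rightarrow> ('g \<Rightarrow> 'w \<Rightarrow> 'w::ab_group_add) \<Rightarrow> ('g \<Rightarrow> 'w) \<Rightarrow> 'g \<times> 'g \<Rightarrow> 'w" where
  "E'_iso G act y =
    (\<Sum>g\<in>carrier G. \<Sum>f\<in>carrier G. single (inv\<^bsub>G\<^esub> f, conj_by G f g) (act f (y g)))"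

definition zeta :: "('g, 'z) monoid_scheme \<Rightarrow> ('g \<Rightarrow> 'g) \<Rightarrow> 'g \<Rightarrow> 'g \<Rightarrow> 'g" where
  "zeta G q c g = inv\<^bsub>G\<^esub> (q (conj_by G g c)) \<otimes>\<^bsub>G\<^esub> g \<otimes>\<^bsub>G\<^esub> q c"

definition coset_V_coaction ::
  "('g, 'z) monoid_scheme \<Rightarrow> 'g set \<Rightarrow> 'g \<Rightarrow> ('g \<Rightarrow> 'g) \<Rightarrow> ('g \<Rightarrow> 'v \<Rightarrow> 'v::ab_group_add) \<Rightarrow>
     ('g \<Rightarrow> 'v) \<Rightarrow> ('g \<times> 'g) \<times> 'g \<Rightarrow> 'v" where
  "coset_V_coaction G C r q \<pi> \<phi> =
    (\<Sum>c\<in>C. \<Sum>f\<in>carrier G. basis_tensor (f, conj_by G (inv\<^bsub>G\<^esub> f) (inv\<^bsub>G\<^esub> c))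
       (coset_delta G (centralizer G r) (q (conj_by G (inv\<^bsub>G\<^esub> f) c))
         (\<pi> (zeta G q c (inv\<^bsub>G\<^esub> f)) (\<phi> (q c)))))"

definition group_W_coaction ::
  "('g, 'z) monoid_scheme \<Rightarrow> ('g \<Rightarrow> 'w \<Rightarrow> 'w::ab_group_add) \<Rightarrow> ('g \<Rightarrow> 'w) \<Rightarrow> ('g \<times> 'g) \<times> 'g \<Rightarrow> 'w" where
  "group_W_coaction G act y =
    (\<Sum>g\<in>carrier G. \<Sum>f\<in>carrier G. basis_tensor (f, conj_by G (inv\<^bsub>G\<^esub> f) g)
       (single (conj_by G (inv\<^bsub>G\<^esub> f) g) (act (inv\<^bsub>G\<^esub> f) (y g))))"

definition cov ::
  "('g, 'z) monoid_scheme \<Rightarrow> 'g set \<Rightarrow> 'g \<Rightarrow> ('g \<Rightarrow> 'g) \<Rightarrow> ('g \<Rightarrow> 'w \<Rightarrow> 'w::ab_group_add) \<Rightarrow> ('g \<Rightarrow> 'w) \<Rightarrow> 'g \<Rightarrow> 'w"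
  where "cov G C r q act \<psi> = (\<Sum>c\<in>C. coset_delta G (centralizer G r) (q c) (act (q c) (\<psi> (q c))))"

text \<open>\<open>(\<integral> x\<^sup>1 a) x\<^sup>2\<close> for \<open>x\<close> a function on the cosets with values in \<open>W\<close>.\<close>
definition integrate_against ::
  "('g, 'z) monoid_scheme \<Rightarrow> 'g set \<Rightarrow> 'g \<Rightarrow> ('g \<Rightarrow> 'g) \<Rightarrow> (complex \<Rightarrow> 'w \<Rightarrow> 'w::ab_group_add) \<Rightarrow>
     ('g \<Rightarrow> 'w) \<Rightarrow> ('g \<Rightarrow> complex) \<Rightarrow> 'w" where
  "integrate_against G C r q s x a =
    (\<Sum>c\<in>C. s (coset_integral G C r q (coset_delta G (centralizer G r) (q c) 1 * a)) (x (q c)))"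

text \<open>The inclusion of \<open>V\<close> into \<open>W\<close> is \<open>\<iota>\<close>.\<close>
definition cov_embedding ::
  "('g, 'z) monoid_scheme \<Rightarrow> 'g set \<Rightarrow> 'g \<Rightarrow> ('g \<Rightarrow> 'g) \<Rightarrow> (complex \<Rightarrow> 'w \<Rightarrow> 'w::ab_group_add) \<Rightarrow>
     ('g \<Rightarrow> 'w \<Rightarrow> 'w) \<Rightarrow> ('v \<Rightarrow> 'w) \<Rightarrow> ('g \<Rightarrow> 'v) \<Rightarrow> 'g \<Rightarrow> 'w" where
  "cov_embedding G C r q s act \<iota> \<phi> =
    (\<Sum>c\<in>C. single (inv\<^bsub>G\<^esub> c)
       (integrate_against G C r q s (cov G C r q act (\<iota> \<circ> \<phi>)) (coset_delta G (centralizer G r) (q c) 1)))"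

end

theory Submission
  imports Defs
begin

text \<open>
  Every structure map is computed pointwise on basis elements \<open>\<delta>\<^sub>f \<otimes> h\<close>. In these coordinates \<open>E\<close>
  consists of the \<open>x\<close> supported on \<open>h = r\<^sup>-\<^sup>1\<close> with \<open>k \<triangleright> x(fk, r\<^sup>-\<^sup>1) = x(f, r\<^sup>-\<^sup>1)\<close> for \<open>k \<in> C\<^sub>G\<close>, \<open>E'\<close> of the
  \<open>x\<close> with \<open>j \<triangleright> x(fj, j\<^sup>-\<^sup>1hj) = x(f, h)\<close> for all \<open>j\<close>, and averaging replaces \<open>x(f, h)\<close> by the mean of
  \<open>k \<triangleright> x(fk, k\<^sup>-\<^sup>1hk)\<close> over \<open>k\<close>. The inclusion of \<open>V\<close> into the pushout of \<open>W\<close> puts \<open>V\<close> in degree \<open>r\<close> and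
  makes it \<open>C\<^sub>G\<close>-equivariant. So for an element of \<open>E\<close> only the \<open>k\<close> with \<open>krk\<^sup>-\<^sup>1 = h\<^sup>-\<^sup>1\<close> contribute to the
  average; they form one coset of \<open>C\<^sub>G\<close> and contribute equally, whence the factor \<open>|C\<^sub>G|/|G|\<close>.
\<close>

section \<open>Comodules over the dual of the quantum double\<close>

lemma sum_fun_apply: "(\<Sum>i\<in>I. F i) b = (\<Sum>i\<in>I. F i b)"
  by (induction I rule: infinite_finite_induct) auto

lemma fun_eq_pairI: "(\<And>a b. F (a, b) = H (a, b)) \<Longrightarrow> F = H"
  by auto

text \<open>Serves when a condition on the summation index can be solved: \<open>a\<close> is the
  only candidate, and \<open>Q\<close> is what remains of the condition once the index is
  eliminated.\<close>

lemma sum_if_unique: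
  assumes "finite A" "\<And>x. x \<in> A \<Longrightarrow> P x \<longleftrightarrow> Q \<and> x = a" "Q \<Longrightarrow> a \<in> A"
  shows "(\<Sum>x\<in>A. if P x then v x else 0) = (if Q then v a else 0)"
proof -
  have "(\<Sum>x\<in>A. if P x then v x else 0) = (\<Sum>x\<in>A. if x = a then if Q then v a else 0 else 0)"
    using assms(2) by (intro sum.cong) auto
  with assms show ?thesis by auto
qed

lemma sum_if_unique2:
  assumes "\<And>x y. x \<in> A \<Longrightarrow> y \<in> B \<Longrightarrow> P x y \<longleftrightarrow> Q \<and> x = a \<and> y = b"
    and "finite A" "finite B" "Q \<Longrightarrow> a \<in> A" "Q \<Longrightarrow> b \<in> B"
  shows "(\<Sum>x\<in>A. \<Sum>y\<in>B. if P x y then v x y else 0) = (if Q then v a b else 0)"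
proof -
  have "(\<Sum>x\<in>A. \<Sum>y\<in>B. if P x y then v x y else 0) =
    (\<Sum>x\<in>A. if x = a \<and> Q then v a b else 0)"
  proof (rule sum.cong[OF refl])
    fix x assume "x \<in> A"
    have "(\<Sum>y\<in>B. if P x y then v x y else 0) = (if x = a \<and> Q then v x b else 0)"
      by (rule sum_if_unique) (use assms \<open>x \<in> A\<close> in auto)
    then show "(\<Sum>y\<in>B. if P x y then v x y else 0) = (if x = a \<and> Q then v a b else 0)"
      by auto
  qed
  also have "\<dots> = (if Q then v a b else 0)"
    by (rule sum_if_unique) (use assms in auto)
  finally show ?thesis .
qed

lemma fun_eq_pairs_iff: "F = H \<longleftrightarrow> (\<forall>a b c d. F ((a, b), (c, d)) = H ((a, b), (c, d)))"
  unfolding fun_eq_iff by (metis surj_pair)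

lemma vector_space_fscale:
  assumes "vector_space s"
  shows "vector_space (fscale s)"
proof -
  interpret vector_space s by fact
  show ?thesis
    by unfold_locales (auto simp: fscale_def fun_eq_iff scale_right_distrib scale_left_distrib)
qed

lemma supported_mono: "A \<subseteq> B \<Longrightarrow> supported A \<subseteq> supported B"
  by (auto simp: supported_def)

text \<open>Only the basis vector at \<open>b = p\<close> has a nonzero coefficient. Sums that apply
  a map to \<open>single b 1\<close> collapse this way once the map is known in coordinates.\<close>

lemma sum_scale_single:
  assumes "vector_space s" "finite B"
  shows "(\<Sum>b\<in>B. s (single b 1 p) (y b)) = (if p \<in> B then y p else 0)"
proof -
  interpret vector_space s by fact
  have "(\<Sum>b\<in>B. s (single b 1 p) (y b)) = (\<Sum>b\<in>B. if b = p then y p else 0)"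
    by (rule sum.cong) (auto simp: single_def)
  then show ?thesis
    using assms by simp
qed

lemma tensor_id_apply: "tensor_id s B T x c = (\<Sum>b\<in>B. s (T (single b 1) c) (x b))"
  by (simp add: tensor_id_def sum_fun_apply pure_tensor_def)

section \<open>Conjugation in a finite group\<close>

locale finite_group = group G for G (structure) +
  assumes finite_carrier [simp]: "finite (carrier G)"
begin

lemma inv_cancel [simp]:
  assumes "x \<in> carrier G" "y \<in> carrier G"
  shows "inv x \<otimes> (x \<otimes> y) = y" "x \<otimes> (inv x \<otimes> y) = y"
  using assms by (simp_all flip: m_assoc)

lemma conj_by_closed [simp]: "g \<in> carrier G \<Longrightarrow> h \<in> carrier G \<Longrightarrow> conj_by G g h \<in> carrier G"
  by (simp add: conj_by_def)

lemma conj_by_one [simp]: "h \<in> carrier G \<Longrightarrow> conj_by G \<one> h = h"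
  by (simp add: conj_by_def)

lemma conj_by_mult:
  "g \<in> carrier G \<Longrightarrow> k \<in> carrier G \<Longrightarrow> h \<in> carrier G \<Longrightarrow>
    conj_by G (g \<otimes> k) h = conj_by G g (conj_by G k h)"
  by (simp add: conj_by_def m_assoc inv_mult_group)

lemma conj_by_inv_cancel [simp]:
  assumes "g \<in> carrier G" "h \<in> carrier G"
  shows "conj_by G g (conj_by G (inv g) h) = h" "conj_by G (inv g) (conj_by G g h) = h"
  using assms by (simp_all flip: conj_by_mult)

lemma inv_conj_by:
  "g \<in> carrier G \<Longrightarrow> h \<in> carrier G \<Longrightarrow> inv (conj_by G g h) = conj_by G g (inv h)"
  by (simp add: conj_by_def m_assoc inv_mult_group)

section \<open>Coproduct and counit of the dual double in coordinates\<close>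

lemma hbasis_dual_double [simp]: "hbasis (dual_double G) = carrier G \<times> carrier G"
  by (simp add: dual_double_def double_quotient_def)

lemma hbasis_fun_hopf [simp]: "hbasis (fun_hopf G) = carrier G"
  by (simp add: fun_hopf_def)

text \<open>Solving \<open>k = inv f \<otimes> g\<close> for \<open>g = f \<otimes> k\<close> leaves
  at most one summand of the triple sum, and \<open>h'\<close> is then forced to be the conjugate of
  \<open>h\<close> by \<open>k\<close>.\<close>

lemma hcomult_apply:
  "hcomult (dual_double G) a ((f, h'), (k, h)) =
    (if f \<in> carrier G \<and> k \<in> carrier G \<and> h \<in> carrier G \<and> h' = conj_by G k h then a (f \<otimes> k, h) else 0)"
proof -
  let ?X = "if k \<in> carrier G \<and> h' = conj_by G k h then a (f \<otimes> k, h) else 0"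
  have "hcomult (dual_double G) a ((f, h'), (k, h)) =
    (\<Sum>g\<in>carrier G. \<Sum>h0\<in>carrier G. \<Sum>f0\<in>carrier G.
      if f0 = f then if h0 = h then if g = f \<otimes> k then ?X else 0 else 0 else 0)"
    unfolding dual_double_def double_quotient_def hopf.simps sum_fun_apply
  proof (intro sum.cong refl)
    fix g h0 f0
    assume A: "g \<in> carrier G" "h0 \<in> carrier G" "f0 \<in> carrier G"
    have *: "k = inv f0 \<otimes> g \<longleftrightarrow> k \<in> carrier G \<and> g = f0 \<otimes> k"
      using A by auto
    show "single ((f0, conj_by G (inv f0 \<otimes> g) h0), inv f0 \<otimes> g, h0) (a (g, h0)) ((f, h'), k, h) =
      (if f0 = f then if h0 = h then if g = f \<otimes> k then ?X else 0 else 0 else 0)"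
      using A * by (auto simp: single_def)
  qed
  also have "\<dots> = (if f \<in> carrier G \<and> k \<in> carrier G \<and> h \<in> carrier G \<and> h' = conj_by G k h
      then a (f \<otimes> k, h) else 0)"
    by (cases "f \<in> carrier G"; cases "h \<in> carrier G"; cases "k \<in> carrier G") (simp_all add: sum.delta)
  finally show ?thesis .
qed

lemma tensor_id_hcomult:
  assumes "vector_space s"
  shows "tensor_id s (carrier G \<times> carrier G) (hcomult (dual_double G)) y ((f, h'), (k, h)) =
    (if f \<in> carrier G \<and> k \<in> carrier G \<and> h \<in> carrier G \<and> h' = conj_by G k h then y (f \<otimes> k, h) else 0)"
proof -
  interpret vector_space s by fact
  show ?thesis
    using sum_scale_single[OF assms, of "carrier G \<times> carrier G" "(f \<otimes> k, h)" y]
    by (auto simp: tensor_id_apply hcomult_apply)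
qed

lemma counit_apply:
  assumes "vector_space s"
  shows "(\<Sum>b\<in>hbasis (dual_double G). s (hcounit (dual_double G) (single b 1)) (y b)) =
    (\<Sum>h\<in>carrier G. y (\<one>, h))"
proof -
  interpret vector_space s by fact
  have "(\<Sum>b\<in>hbasis (dual_double G). s (hcounit (dual_double G) (single b 1)) (y b)) =
    (\<Sum>h\<in>carrier G. \<Sum>b\<in>carrier G \<times> carrier G. s (single b 1 (\<one>, h)) (y b))"
    by (subst sum.swap) (simp add: dual_double_def double_quotient_def scale_sum_left)
  also have "\<dots> = (\<Sum>h\<in>carrier G. y (\<one>, h))"
    by (intro sum.cong refl) (subst sum_scale_single[OF assms], auto)
  finally show ?thesis .
qed

text \<open>Since the coproduct has at most one nonzero summand per coordinate, coassociativity
  becomes a single identity between the iterated coaction and the coefficient at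
  \<open>f \<otimes> k\<close>; the counit law likewise only sees the coefficients at the
  identity.\<close>

lemma left_comoduleI:
  fixes s :: "complex \<Rightarrow> 'v \<Rightarrow> 'v::ab_group_add"
  assumes s: "vector_space s"
    and M: "0 \<in> M" "\<And>x y. x \<in> M \<Longrightarrow> y \<in> M \<Longrightarrow> x + y \<in> M" "\<And>a x. x \<in> M \<Longrightarrow> fscale s a x \<in> M"
    and add: "\<And>x y f h m. x \<in> M \<Longrightarrow> y \<in> M \<Longrightarrow> L (x + y) ((f, h), m) = L x ((f, h), m) + L y ((f, h), m)"
    and scale: "\<And>a x f h m. x \<in> M \<Longrightarrow> L (fscale s a x) ((f, h), m) = s a (L x ((f, h), m))"
    and closed: "\<And>x f h. x \<in> M \<Longrightarrow> (\<lambda>m. L x ((f, h), m)) \<in> M"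
    and supp: "\<And>x f h m. x \<in> M \<Longrightarrow> f \<notin> carrier G \<or> h \<notin> carrier G \<Longrightarrow> L x ((f, h), m) = 0"
    and coassoc: "\<And>x f h' k h m. x \<in> M \<Longrightarrow> L (\<lambda>m'. L x ((f, h'), m')) ((k, h), m) =
      (if f \<in> carrier G \<and> k \<in> carrier G \<and> h \<in> carrier G \<and> h' = conj_by G k h
       then L x ((f \<otimes> k, h), m) else 0)"
    and counit: "\<And>x m. x \<in> M \<Longrightarrow> (\<Sum>h\<in>carrier G. L x ((\<one>, h), m)) = x m"
  shows "left_comodule (dual_double G) s M L"
proof -
  interpret f: vector_space "fscale s" by (rule vector_space_fscale[OF s])
  show ?thesis
    unfolding left_comodule_def counit_apply[OF s] f.subspace_def
    using assms
    by (auto simp: tensor_id_hcomult[OF s] counit fscale_def intro!: ext)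
qed

lemma comult_first_apply:
  assumes "vector_space s"
  shows "comult_first G s x ((f, h'), (k, h)) =
    (if f \<in> carrier G \<and> k \<in> carrier G \<and> h \<in> carrier G \<and> h' = conj_by G k h then x (f \<otimes> k, h) else 0)"
  by (simp add: comult_first_def tensor_id_hcomult[OF assms])

text \<open>The comodule laws come from the coproduct on the first factor alone, by associativity in
  the group. What depends on \<open>M\<close> is that it is a subspace with the right support,
  stable under taking coefficients.\<close>

lemma left_comodule_comult_first:
  fixes s :: "complex \<Rightarrow> 'v \<Rightarrow> 'v::ab_group_add"
  assumes s: "vector_space s"
    and M: "0 \<in> M" "\<And>x y. x \<in> M \<Longrightarrow> y \<in> M \<Longrightarrow> x + y \<in> M" "\<And>a x. x \<in> M \<Longrightarrow> fscale s a x \<in> M"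
    and supp: "M \<subseteq> supported (carrier G \<times> carrier G)"
    and closed: "\<And>x f h. x \<in> M \<Longrightarrow> (\<lambda>m. comult_first G s x ((f, h), m)) \<in> M"
  shows "left_comodule (dual_double G) s M (comult_first G s)"
proof (rule left_comoduleI[OF s M _ _ closed])
  interpret vector_space s by fact
  show "comult_first G s (x + y) ((f, h), m) = comult_first G s x ((f, h), m) + comult_first G s y ((f, h), m)"
    for x y f h m
    by (cases m) (simp add: comult_first_apply[OF s])
  show "comult_first G s (fscale s a x) ((f, h), m) = s a (comult_first G s x ((f, h), m))" for a x f h m
    by (cases m) (simp add: comult_first_apply[OF s] fscale_def)
  show "comult_first G s x ((f, h), m) = 0" if "f \<notin> carrier G \<or> h \<notin> carrier G" for x f h m
    using that by (cases m) (auto simp: comult_first_apply[OF s])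
  show "comult_first G s (\<lambda>m'. comult_first G s x ((f, h'), m')) ((k, h), m) =
    (if f \<in> carrier G \<and> k \<in> carrier G \<and> h \<in> carrier G \<and> h' = conj_by G k h
     then comult_first G s x ((f \<otimes> k, h), m) else 0)" for x f h' k h m
    by (cases m) (auto simp: comult_first_apply[OF s] conj_by_mult m_assoc)
  show "(\<Sum>h\<in>carrier G. comult_first G s x ((\<one>, h), m)) = x m" if "x \<in> M" for x m
  proof (cases m)
    case (Pair k l)
    \<comment> \<open>At the identity the coproduct forces \<open>h = conj_by G k l\<close>, so at
      most one \<open>h\<close> contributes; the support of \<open>x\<close> settles indices outside
      the carrier.\<close>
    have "(\<Sum>h\<in>carrier G. comult_first G s x ((\<one>, h), m)) =
      (\<Sum>h\<in>carrier G. if h = conj_by G k l then if k \<in> carrier G \<and> l \<in> carrier G then x (k, l) else 0 else 0)"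
      by (intro sum.cong) (auto simp: Pair comult_first_apply[OF s])
    also have "\<dots> = x (k, l)"
      using supp that by (auto simp: supported_def)
    finally show ?thesis by (simp add: Pair)
  qed
qed

section \<open>Pushing forward to the functions on the group, and their integral\<close>

lemma to_fun_apply: "to_fun G a k = (if k \<in> carrier G then \<Sum>h\<in>carrier G. a (k, h) else 0)"
proof -
  have "to_fun G a k = (\<Sum>g\<in>carrier G. if g = k then \<Sum>h\<in>carrier G. a (k, h) else 0)"
    unfolding to_fun_def sum_fun_apply by (intro sum.cong) (auto simp: single_def)
  then show ?thesis by simp
qed

text \<open>Applying \<open>to_fun G\<close> sums over the group-algebra index of the second
  coproduct factor. Because \<open>h'\<close> is the conjugate of that index by \<open>k\<close>,
  only \<open>conj_by G (inv k) h'\<close> survives.\<close>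

lemma D_coaction_to_fun:
  "D_coaction G (to_fun G) a ((f, h'), k) =
    (if f \<in> carrier G \<and> h' \<in> carrier G \<and> k \<in> carrier G then a (f \<otimes> k, conj_by G (inv k) h') else 0)"
proof -
  have "D_coaction G (to_fun G) a ((f, h'), k) =
    (if k \<in> carrier G then \<Sum>h\<in>carrier G. if h = conj_by G (inv k) h' then
       if f \<in> carrier G \<and> h' \<in> carrier G then a (f \<otimes> k, conj_by G (inv k) h') else 0 else 0 else 0)"
    unfolding D_coaction_def id_tensor_def to_fun_apply split hcomult_apply
    by (intro if_cong[OF refl _ refl] sum.cong refl) auto
  then show ?thesis by auto
qed

text \<open>Distinct \<delta> functions multiply to zero, so the diagonal coaction only pairs
  components carrying the same group element \<open>j\<close>.\<close>

lemma tensor_coaction_fun_hopf: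
  assumes s: "vector_space s"
  shows "tensor_coaction (fun_hopf G) s B \<sigma> R x (b, j) =
    (if j \<in> carrier G then \<Sum>b'\<in>B. s (\<sigma> (single b' 1) (b, j)) (R (x b') j) else 0)"
proof -
  interpret vector_space s by fact
  have "tensor_coaction (fun_hopf G) s B \<sigma> R x (b, j) =
    (\<Sum>b'\<in>B. \<Sum>k\<in>carrier G. \<Sum>l\<in>carrier G.
      if l = j then if k = j then s (\<sigma> (single b' 1) (b, j)) (R (x b') j) else 0 else 0)"
    unfolding tensor_coaction_def fun_hopf_def hopf.simps sum_fun_apply split
    by (intro sum.cong) (auto simp: single_def)
  then show ?thesis by simp
qed

text \<open>The antipode of the function algebra is composition with inversion, so its square is the
  identity on the carrier; orthogonality of the \<delta> functions then leaves one point of mass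
  1/|G|.\<close>

lemma fun_integral_antipode:
  assumes "k \<in> carrier G" "l \<in> carrier G"
  shows "fun_integral G (hmult (fun_hopf G) (single l 1)
      (hantipode (fun_hopf G) (hantipode (fun_hopf G) (single k 1)))) =
    (if l = k then 1 / of_nat (card (carrier G)) else 0)"
proof -
  have S: "hantipode (fun_hopf G) a = (\<lambda>g. if g \<in> carrier G then a (inv g) else 0)" for a
  proof
    fix g
    have "hantipode (fun_hopf G) a g =
      (\<Sum>h\<in>carrier G. if h = inv g then if g \<in> carrier G then a (inv g) else 0 else 0)"
      unfolding fun_hopf_def hopf.simps sum_fun_apply by (intro sum.cong) (auto simp: single_def)
    then show "hantipode (fun_hopf G) a g = (if g \<in> carrier G then a (inv g) else 0)" by auto
  qed
  have "fun_integral G (hmult (fun_hopf G) (single l 1)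
      (hantipode (fun_hopf G) (hantipode (fun_hopf G) (single k 1)))) =
    1 / of_nat (card (carrier G)) * (\<Sum>g\<in>carrier G. if g = k then if l = k then 1 else 0 else 0)"
    unfolding S fun_integral_def
    by (intro arg_cong2[where f = "(*)"] sum.cong) (auto simp: fun_hopf_def single_def)
  then show ?thesis using assms by auto
qed

end

section \<open>Linear representations of a subgroup\<close>

locale subgroup_representation = finite_group G for G (structure) +
  fixes K :: "'a set" and s :: "complex \<Rightarrow> 'v \<Rightarrow> 'v::ab_group_add" and \<pi> :: "'a \<Rightarrow> 'v \<Rightarrow> 'v"
  assumes vs: "vector_space s"
    and K_subgroup: "subgroup K G"
    and rep: "representation G K s \<pi>"
begin

sublocale vector_space s by (rule vs)

lemma rep_linear: "g \<in> K \<Longrightarrow> Vector_Spaces.linear s s (\<pi> g)"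
  using rep by (simp add: Defs.representation_def)

lemma rep_add: "g \<in> K \<Longrightarrow> \<pi> g (v + w) = \<pi> g v + \<pi> g w"
  and rep_scale: "g \<in> K \<Longrightarrow> \<pi> g (s a v) = s a (\<pi> g v)"
  using rep_linear unfolding Vector_Spaces.linear_iff by blast+

lemma rep_zero [simp]: "g \<in> K \<Longrightarrow> \<pi> g 0 = 0"
  using rep_add[of g 0 0] by simp

lemma rep_sum: "g \<in> K \<Longrightarrow> \<pi> g (\<Sum>i\<in>I. v i) = (\<Sum>i\<in>I. \<pi> g (v i))"
  by (induction I rule: infinite_finite_induct) (auto simp: rep_add)

lemma rep_one [simp]: "\<pi> \<one> v = v"
  using rep by (simp add: Defs.representation_def)

lemma rep_rep: "g \<in> K \<Longrightarrow> h \<in> K \<Longrightarrow> \<pi> g (\<pi> h v) = \<pi> (g \<otimes> h) v"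
  using rep by (simp add: Defs.representation_def)

lemma K_closed [simp]: "g \<in> K \<Longrightarrow> g \<in> carrier G" "\<one> \<in> K" "g \<in> K \<Longrightarrow> inv g \<in> K"
  "g \<in> K \<Longrightarrow> h \<in> K \<Longrightarrow> g \<otimes> h \<in> K"
  using K_subgroup
  by (auto simp: subgroup.mem_carrier subgroup.one_closed subgroup.m_inv_closed subgroup.m_closed)

lemma rep_inv_cancel [simp]: "g \<in> K \<Longrightarrow> \<pi> g (\<pi> (inv g) v) = v" "g \<in> K \<Longrightarrow> \<pi> (inv g) (\<pi> g v) = v"
  by (simp_all add: rep_rep)

end

section \<open>Crossed modules and averaging\<close>

locale crossed_comodule = subgroup_representation G "carrier G" s act
  for G :: "('g, 'z) monoid_scheme" (structure)
    and s :: "complex \<Rightarrow> 'w \<Rightarrow> 'w::ab_group_add" and act :: "'g \<Rightarrow> 'w \<Rightarrow> 'w" +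
  fixes \<rho> :: "'w \<Rightarrow> 'g \<times> 'g \<Rightarrow> 'w" and gr :: "'g \<Rightarrow> 'w set"
  assumes comodule: "right_comodule (dual_double G) s \<rho>"
    and crossed: "crossed_module G s act gr"
    and coaction_homogeneous:
      "\<And>d w. d \<in> carrier G \<Longrightarrow> w \<in> gr d \<Longrightarrow> \<rho> w = (\<Sum>g\<in>carrier G. single (g, d) (act g w))"
begin

text \<open>The coaction is prescribed on homogeneous elements only. Splitting \<open>w\<close> by
  degree and using linearity gives it everywhere; \<open>u d\<close> is the part of degree
  \<open>d\<close>.\<close>

lemma coaction_decomposition:
  obtains u where "\<And>d. d \<in> carrier G \<Longrightarrow> u d \<in> gr d" "w = (\<Sum>d\<in>carrier G. u d)"
    "\<And>g d. \<rho> w (g, d) = (if g \<in> carrier G \<and> d \<in> carrier G then act g (u d) else 0)"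
proof -
  obtain u where u: "\<And>d. d \<in> carrier G \<Longrightarrow> u d \<in> gr d" "w = (\<Sum>d\<in>carrier G. u d)"
    using crossed unfolding crossed_module_def by blast
  interpret lin: Vector_Spaces.linear s "fscale s" \<rho>
    using comodule by (simp add: right_comodule_def)
  have "\<rho> w (g, d) = (if g \<in> carrier G \<and> d \<in> carrier G then act g (u d) else 0)" for g d
  proof -
    have "\<rho> w (g, d) = (\<Sum>d'\<in>carrier G. \<rho> (u d') (g, d))"
      unfolding u(2) lin.sum sum_fun_apply ..
    also have "\<dots> = (\<Sum>d'\<in>carrier G. \<Sum>g'\<in>carrier G.
        if g' = g then if d' = d then act g (u d) else 0 else 0)"
      by (intro sum.cong refl) (auto simp: coaction_homogeneous u(1) sum_fun_apply single_def intro!: sum.cong)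
    also have "\<dots> = (if g \<in> carrier G \<and> d \<in> carrier G then act g (u d) else 0)"
      by (auto intro!: sum.neutral)
    finally show ?thesis .
  qed
  with u that show ?thesis by blast
qed

text \<open>Forgetting the degree sums the components \<open>\<rho> w (j, h)\<close> over
  \<open>h\<close>. These are the images under \<open>act j\<close> of the homogeneous parts of
  \<open>w\<close>, so what is left of the coaction is the group action.\<close>

lemma fun_pushout_apply: "fun_pushout G s \<rho> w j = (if j \<in> carrier G then act j w else 0)"
proof -
  obtain u where u: "w = (\<Sum>d\<in>carrier G. u d)"
    "\<And>g d. \<rho> w (g, d) = (if g \<in> carrier G \<and> d \<in> carrier G then act g (u d) else 0)"
    using coaction_decomposition[of w] by metis
  have "fun_pushout G s \<rho> w j = (if j \<in> carrier G then
      \<Sum>h\<in>carrier G. \<Sum>b\<in>carrier G \<times> carrier G. s (single b 1 (j, h)) (\<rho> w b) else 0)"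
    by (subst sum.swap) (simp add: fun_pushout_def pushout_def tensor_id_apply to_fun_apply scale_sum_left)
  also have "\<dots> = (if j \<in> carrier G then \<Sum>h\<in>carrier G. \<rho> w (j, h) else 0)"
    by (auto simp: sum_scale_single[OF vs])
  also have "\<dots> = (if j \<in> carrier G then act j w else 0)"
    using arg_cong[OF u(1), of "act j"] by (auto simp: u(2) rep_sum)
  finally show ?thesis .
qed

section \<open>The invariants E' in coordinates\<close>

lemma E'_coaction_apply:
  "tensor_coaction (fun_hopf G) s (carrier G \<times> carrier G) (D_coaction G (to_fun G)) (fun_pushout G s \<rho>) x ((f, h), j) =
    (if f \<in> carrier G \<and> h \<in> carrier G \<and> j \<in> carrier G then act j (x (f \<otimes> j, conj_by G (inv j) h)) else 0)"
proof (cases "f \<in> carrier G \<and> h \<in> carrier G \<and> j \<in> carrier G")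
  case True
  then show ?thesis
    using sum_scale_single[OF vs, of "carrier G \<times> carrier G" "(f \<otimes> j, conj_by G (inv j) h)" "\<lambda>b. act j (x b)"]
    by (simp add: tensor_coaction_fun_hopf[OF vs] D_coaction_to_fun fun_pushout_apply)
next
  case False
  then show ?thesis by (auto simp: tensor_coaction_fun_hopf[OF vs] D_coaction_to_fun)
qed

text \<open>The unit of the function algebra is constantly 1 on the group, so invariance can be read
  off at each \<open>j\<close> separately.\<close>

lemma E'_iff:
  "x \<in> E' G s \<rho> \<longleftrightarrow> x \<in> supported (carrier G \<times> carrier G) \<and>
    (\<forall>f\<in>carrier G. \<forall>h\<in>carrier G. \<forall>j\<in>carrier G. act j (x (f \<otimes> j, conj_by G (inv j) h)) = x (f, h))"
proof -
  have unit: "hunit (fun_hopf G) k = (if k \<in> carrier G then 1 else 0)" for k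
    by (simp add: fun_hopf_def sum_fun_apply single_def)
  show ?thesis
    unfolding E'_def Let_def invariants_def fun_eq_iff split_paired_All hbasis_dual_double
    by (auto simp: E'_coaction_apply unit supported_def)
qed

text \<open>The coordinate determines both summation indices: \<open>f = inv a\<close> from its
  first entry, and then \<open>g = conj_by G a b\<close> from its second.\<close>

lemma E'_iso_apply:
  "E'_iso G act y (a, b) = (if a \<in> carrier G \<and> b \<in> carrier G then act (inv a) (y (conj_by G a b)) else 0)"
proof -
  have "E'_iso G act y (a, b) = (\<Sum>g\<in>carrier G. \<Sum>f\<in>carrier G.
    if f = inv a then if g = conj_by G a b then
      if a \<in> carrier G \<and> b \<in> carrier G then act (inv a) (y (conj_by G a b)) else 0 else 0 else 0)"
    unfolding E'_iso_def sum_fun_apply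
  proof (intro sum.cong refl)
    fix g f
    assume [simp]: "g \<in> carrier G" "f \<in> carrier G"
    have eq: "(a, b) = (inv f, conj_by G f g) \<longleftrightarrow> f = inv a \<and> g = conj_by G a b \<and> a \<in> carrier G \<and> b \<in> carrier G"
    proof
      assume "f = inv a \<and> g = conj_by G a b \<and> a \<in> carrier G \<and> b \<in> carrier G"
      then show "(a, b) = (inv f, conj_by G f g)" by simp
    qed simp
    show "single (inv f, conj_by G f g) (act f (y g)) (a, b) =
      (if f = inv a then if g = conj_by G a b then
        if a \<in> carrier G \<and> b \<in> carrier G then act (inv a) (y (conj_by G a b)) else 0 else 0 else 0)"
      unfolding single_def eq by (simp only: split: if_split) blast
  qed
  then show ?thesis
    by (cases "a \<in> carrier G \<and> b \<in> carrier G") (simp, simp only: if_False if_cancel sum.neutral_const)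
qed

lemma group_W_coaction_apply:
  "group_W_coaction G act y ((f, h), m) =
    (if f \<in> carrier G \<and> m \<in> carrier G \<and> h = m then act (inv f) (y (conj_by G f m)) else 0)"
proof -
  have "group_W_coaction G act y ((f, h), m) = (\<Sum>g\<in>carrier G. \<Sum>f'\<in>carrier G.
    if f' = f then if g = conj_by G f m then
      if f \<in> carrier G \<and> m \<in> carrier G \<and> h = m then act (inv f) (y (conj_by G f m)) else 0 else 0 else 0)"
    unfolding group_W_coaction_def sum_fun_apply
  proof (intro sum.cong refl)
    fix g f'
    assume [simp]: "g \<in> carrier G" "f' \<in> carrier G"
    have eq: "(f, h) = (f', conj_by G (inv f') g) \<and> m = conj_by G (inv f') g \<longleftrightarrow>
      f' = f \<and> g = conj_by G f m \<and> f \<in> carrier G \<and> m \<in> carrier G \<and> h = m"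
      by (intro iffI; elim conjE; simp)
    have expand: "basis_tensor (f', conj_by G (inv f') g) (single (conj_by G (inv f') g) v) ((f, h), m) =
      (if (f, h) = (f', conj_by G (inv f') g) \<and> m = conj_by G (inv f') g then v else 0)" for v :: 'w
      by (simp add: basis_tensor_def single_def)
    show "basis_tensor (f', conj_by G (inv f') g) (single (conj_by G (inv f') g) (act (inv f') (y g))) ((f, h), m) =
      (if f' = f then if g = conj_by G f m then
        if f \<in> carrier G \<and> m \<in> carrier G \<and> h = m then act (inv f) (y (conj_by G f m)) else 0 else 0 else 0)"
      unfolding expand eq by (simp only: split: if_split) blast
  qed
  then show ?thesis
    by (cases "f \<in> carrier G \<and> m \<in> carrier G \<and> h = m") (simp, simp only: if_False if_cancel sum.neutral_const)
qed

section \<open>Averaging over the group\<close>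

lemma av_apply:
  "av G s \<rho> x (f, h) = (if f \<in> carrier G \<and> h \<in> carrier G then
    s (1 / of_nat (card (carrier G))) (\<Sum>k\<in>carrier G. act k (x (f \<otimes> k, conj_by G (inv k) h))) else 0)"
proof -
  let ?B = "carrier G \<times> carrier G" and ?c = "1 / of_nat (card (carrier G)) :: complex"
  \<comment> \<open>The integral pairs the two \<delta> indices, which forces \<open>l = k\<close>
    and gives the constant \<open>?c\<close>; the sum over \<open>b\<close> afterwards evaluates the
    coaction of the first factor.\<close>
  have "av G s \<rho> x (f, h) = (\<Sum>b\<in>?B. \<Sum>k\<in>carrier G. \<Sum>l\<in>carrier G.
      if l = k then s ?c (s (D_coaction G (to_fun G) (single b 1) ((f, h), k)) (act k (x b))) else 0)"
    unfolding av_def Let_def sum_fun_apply hbasis_dual_double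
    by (intro sum.cong) (simp_all add: fun_integral_antipode fun_pushout_apply)
  also have "\<dots> = s ?c (\<Sum>k\<in>carrier G. \<Sum>b\<in>?B. s (D_coaction G (to_fun G) (single b 1) ((f, h), k)) (act k (x b)))"
    by (subst (2) sum.swap) (simp add: scale_sum_right)
  also have "\<dots> = (if f \<in> carrier G \<and> h \<in> carrier G then
    s ?c (\<Sum>k\<in>carrier G. act k (x (f \<otimes> k, conj_by G (inv k) h))) else 0)"
    by (auto simp: D_coaction_to_fun sum_scale_single[OF vs])
  finally show ?thesis .
qed

text \<open>Acting by \<open>j\<close> after shifting the coordinates by \<open>j\<close> only
  reindexes the average, \<open>k\<close> becoming \<open>j \<otimes> k\<close>; so the mean of any
  \<open>x\<close>, in particular of an element of \<open>E_W\<close>, is invariant.\<close>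

lemma av_in_E': "av G s \<rho> x \<in> E' G s \<rho>"
proof -
  have "act j (av G s \<rho> x (f \<otimes> j, conj_by G (inv j) h)) = av G s \<rho> x (f, h)"
    if [simp]: "f \<in> carrier G" "h \<in> carrier G" "j \<in> carrier G" for f h j
  proof -
    let ?t = "\<lambda>k. act k (x (f \<otimes> k, conj_by G (inv k) h))"
    have "(\<Sum>k\<in>carrier G. act j (act k (x (f \<otimes> j \<otimes> k, conj_by G (inv k) (conj_by G (inv j) h))))) =
      (\<Sum>k\<in>carrier G. ?t (j \<otimes> k))"
      by (intro sum.cong) (simp_all add: rep_rep m_assoc inv_mult_group conj_by_mult)
    also have "\<dots> = (\<Sum>k\<in>carrier G. ?t k)"
      by (rule sum.reindex_bij_witness[of _ "\<lambda>k. inv j \<otimes> k" "\<lambda>k. j \<otimes> k"]) auto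
    finally show ?thesis
      by (simp add: av_apply rep_scale rep_sum)
  qed
  then show ?thesis
    by (auto simp: E'_iff supported_def av_apply)
qed

text \<open>A coefficient of the coproduct shifts the first index from the left, invariance shifts
  it from the right, so the two commute. The conjugation constraint survives because
  \<open>k \<otimes> j\<close> conjugates \<open>conj_by G (inv j) l\<close> to the same element as
  \<open>k\<close> conjugates \<open>l\<close>.\<close>

lemma left_comodule_E': "left_comodule (dual_double G) s (E' G s \<rho>) (comult_first G s)"
proof (rule left_comodule_comult_first[OF vs])
  fix x f h
  assume x: "x \<in> E' G s \<rho>"
  show "(\<lambda>m. comult_first G s x ((f, h), m)) \<in> E' G s \<rho>"
  proof -
    have "act j (comult_first G s x ((f, h), (k \<otimes> j, conj_by G (inv j) l))) = comult_first G s x ((f, h), (k, l))"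
      if [simp]: "k \<in> carrier G" "l \<in> carrier G" "j \<in> carrier G" for k l j
    proof -
      have "act j (x (f \<otimes> k \<otimes> j, conj_by G (inv j) l)) = x (f \<otimes> k, l)" if "f \<in> carrier G"
        using x that unfolding E'_iff by simp
      then show ?thesis
        by (simp add: comult_first_apply[OF vs] conj_by_mult m_assoc)
    qed
    then show ?thesis
      by (auto simp: E'_iff supported_def comult_first_apply[OF vs])
  qed
qed (auto simp: E'_iff supported_def fscale_def rep_add rep_scale)

lemma left_comodule_group_W:
  "left_comodule (dual_double G) s (supported (carrier G)) (group_W_coaction G act)"
proof (rule left_comoduleI[OF vs])
  fix x :: "'g \<Rightarrow> 'w" and m
  assume x: "x \<in> supported (carrier G)"
  have "(\<Sum>h\<in>carrier G. group_W_coaction G act x ((\<one>, h), m)) = (\<Sum>h\<in>carrier G. if h = m then x m else 0)"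
    by (intro sum.cong) (auto simp: group_W_coaction_apply)
  then show "(\<Sum>h\<in>carrier G. group_W_coaction G act x ((\<one>, h), m)) = x m"
    using x by (auto simp: supported_def)
next
  fix x f h' k h m
  show "group_W_coaction G act (\<lambda>m'. group_W_coaction G act x ((f, h'), m')) ((k, h), m) =
    (if f \<in> carrier G \<and> k \<in> carrier G \<and> h \<in> carrier G \<and> h' = conj_by G k h
     then group_W_coaction G act x ((f \<otimes> k, h), m) else 0)"
    by (auto simp: group_W_coaction_apply rep_rep inv_mult_group conj_by_mult)
qed (auto simp: group_W_coaction_apply supported_def fscale_def rep_add rep_scale)

text \<open>An invariant element is determined by its values at the identity in the first slot:
  invariance under \<open>inv a\<close> moves \<open>(a, b)\<close> there, and this is exactly the
  formula for \<open>E'_iso\<close>. The inverse is therefore evaluation at the identity.\<close>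

lemma E'_iso: "left_comodule_iso (dual_double G)
   s (supported (carrier G)) (group_W_coaction G act)
   s (E' G s \<rho>) (comult_first G s) (E'_iso G act)"
proof -
  have in_E': "E'_iso G act y \<in> E' G s \<rho>" for y
    by (auto simp: E'_iff supported_def E'_iso_apply rep_rep inv_mult_group m_assoc conj_by_mult)
  have "bij_betw (E'_iso G act) (supported (carrier G)) (E' G s \<rho>)"
  proof (rule bij_betw_byWitness[where f' = "\<lambda>x g. x (\<one>, g)"])
    show "\<forall>y\<in>supported (carrier G). (\<lambda>g. E'_iso G act y (\<one>, g)) = y"
      by (auto simp: E'_iso_apply supported_def)
    show "\<forall>x\<in>E' G s \<rho>. E'_iso G act (\<lambda>g. x (\<one>, g)) = x"
    proof (intro ballI fun_eq_pairI)
      fix x a b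
      assume x: "x \<in> E' G s \<rho>"
      show "E'_iso G act (\<lambda>g. x (\<one>, g)) (a, b) = x (a, b)"
      proof (cases "a \<in> carrier G \<and> b \<in> carrier G")
        case True
        then have "act (inv a) (x (a \<otimes> inv a, conj_by G (inv (inv a)) b)) = x (a, b)"
          using x unfolding E'_iff by (metis inv_closed)
        with True show ?thesis by (simp add: E'_iso_apply)
      qed (use x in \<open>auto simp: E'_iso_apply E'_iff supported_def\<close>)
    qed
    show "E'_iso G act ` supported (carrier G) \<subseteq> E' G s \<rho>"
      using in_E' by auto
    show "(\<lambda>x g. x (\<one>, g)) ` E' G s \<rho> \<subseteq> supported (carrier G)"
      by (auto simp: E'_iff supported_def)
  qed
  moreover have "id_tensor (E'_iso G act) (group_W_coaction G act y) = comult_first G s (E'_iso G act y)" for y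
    by (intro fun_eq_pairI)
      (auto simp: id_tensor_def E'_iso_apply group_W_coaction_apply comult_first_apply[OF vs]
        rep_rep inv_mult_group conj_by_mult)
  ultimately show ?thesis
    unfolding left_comodule_iso_def left_comodule_hom_def
    using in_E'
    by (auto simp: left_comodule_E' left_comodule_group_W E'_iso_apply fscale_def rep_add rep_scale)
qed

end

section \<open>Cosets of the centralizer\<close>

locale class_section = finite_group G for G :: "('g, 'z) monoid_scheme" (structure) +
  fixes C :: "'g set" and r :: 'g and q :: "'g \<Rightarrow> 'g"
  assumes C_class: "C \<in> conj_classes G" and r_in_C: "r \<in> C"
    and q_in_G: "\<And>c. c \<in> C \<Longrightarrow> q c \<in> carrier G"
    and q_conj: "\<And>c. c \<in> C \<Longrightarrow> q c \<otimes> r \<otimes> inv (q c) = c"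
begin

section \<open>The conjugacy class and the centralizer\<close>

abbreviation "K \<equiv> centralizer G r"

lemma C_subset: "c \<in> C \<Longrightarrow> c \<in> carrier G"
  using C_class by (auto simp: conj_classes_def orbits_def orbit_def)

lemma finite_C [simp]: "finite C"
  using C_subset finite_subset[OF _ finite_carrier] by blast

declare r_in_C [simp]

lemma r_in_G [simp]: "r \<in> carrier G"
  by (rule C_subset[OF r_in_C])

lemma supported_inv_r: "supported (carrier G \<times> {inv r}) \<subseteq> supported (carrier G \<times> carrier G)"
  by (rule supported_mono) auto

lemma conj_by_q: "c \<in> C \<Longrightarrow> conj_by G (q c) r = c"
  by (simp add: conj_by_def q_conj)

lemma conj_by_in_C:
  assumes "g \<in> carrier G" "c \<in> C"
  shows "conj_by G g c \<in> C"
proof -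
  obtain x where x: "x \<in> carrier G" "C = {conj_by G a x | a. a \<in> carrier G}"
    using C_class by (auto simp: conj_classes_def orbits_def orbit_def)
  with assms obtain a where "a \<in> carrier G" "c = conj_by G a x" by auto
  then have "conj_by G g c = conj_by G (g \<otimes> a) x" "g \<otimes> a \<in> carrier G"
    using assms x by (simp_all add: conj_by_mult)
  with x show ?thesis by blast
qed

lemma conj_by_in_C_iff [simp]:
  assumes "g \<in> carrier G" "c \<in> carrier G"
  shows "conj_by G g c \<in> C \<longleftrightarrow> c \<in> C"
  using conj_by_in_C[of "inv g" "conj_by G g c"] conj_by_in_C[of g c] assms by auto

lemma conj_by_r_in_C: "g \<in> carrier G \<Longrightarrow> conj_by G g r \<in> C"
  by simp

lemma centralizer_iff: "g \<in> K \<longleftrightarrow> g \<in> carrier G \<and> conj_by G g r = r"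
proof (cases "g \<in> carrier G")
  case True
  then have "conj_by G g r = r \<longleftrightarrow> g \<otimes> r = r \<otimes> g"
    unfolding conj_by_def by (metis inv_solve_right m_closed r_in_G)
  with True show ?thesis by (simp add: centralizer_def)
qed (simp add: centralizer_def)

lemma centralizer_in_G: "g \<in> K \<Longrightarrow> g \<in> carrier G"
  by (simp add: centralizer_def)

lemma conj_by_centralizer: "g \<in> K \<Longrightarrow> conj_by G g r = r" "g \<in> K \<Longrightarrow> conj_by G g (inv r) = inv r"
  by (auto simp: centralizer_iff simp flip: inv_conj_by)

lemma subgroup_centralizer: "subgroup K G"
proof (rule subgroupI)
  show "K \<noteq> {}" using centralizer_iff[of \<one>] by auto
  show "inv g \<in> K" if "g \<in> K" for g
    using that conj_by_inv_cancel(2)[of g r] by (simp add: centralizer_iff)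
qed (auto simp: centralizer_iff conj_by_mult)

lemma finite_centralizer [simp]: "finite K"
  using centralizer_in_G finite_subset[OF _ finite_carrier] by blast

text \<open>The element of the centralizer that moves \<open>a\<close> to the chosen representative of its coset:
  \<open>a \<otimes> kappa a = q\<^sub>c\<close> for \<open>c = a r a\<^sup>-\<^sup>1\<close>.\<close>
definition kappa :: "'g \<Rightarrow> 'g" where
  "kappa a = inv a \<otimes> q (conj_by G a r)"

lemma q_conj_in_G [simp]: "a \<in> carrier G \<Longrightarrow> q (conj_by G a r) \<in> carrier G"
  by (simp add: q_in_G conj_by_r_in_C)

lemma kappa_in_K [simp]: "a \<in> carrier G \<Longrightarrow> kappa a \<in> K"
  by (simp add: kappa_def centralizer_iff conj_by_mult conj_by_q conj_by_r_in_C)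

lemma kappa_in_G [simp]: "a \<in> carrier G \<Longrightarrow> kappa a \<in> carrier G"
  by (simp add: kappa_def)

lemma mult_kappa: "a \<in> carrier G \<Longrightarrow> a \<otimes> kappa a = q (conj_by G a r)"
  by (simp add: kappa_def)

text \<open>\<open>a\<close> and \<open>a \<otimes> k\<close> lie in the same coset and have the
  same representative; the element moving the latter to it must first undo \<open>k\<close>.\<close>

lemma kappa_mult:
  "a \<in> carrier G \<Longrightarrow> k \<in> K \<Longrightarrow> kappa (a \<otimes> k) = inv k \<otimes> kappa a"
  by (simp add: kappa_def conj_by_mult conj_by_centralizer centralizer_in_G inv_mult_group m_assoc)

lemma kappa_q: "c \<in> C \<Longrightarrow> kappa (q c) = \<one>"
  by (simp add: kappa_def conj_by_q q_in_G)

section \<open>Functions on the coset space and their integral\<close>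

lemma coset_functions_iff:
  "\<phi> \<in> coset_functions G K \<longleftrightarrow> \<phi> \<in> supported (carrier G) \<and>
    (\<forall>a\<in>carrier G. \<forall>n\<in>K. \<phi> (a \<otimes> n) = \<phi> a)"
  by (simp add: coset_functions_def)

text \<open>If \<open>a\<close> and \<open>b\<close> conjugate \<open>r\<close> to the same element,
  then \<open>inv a \<otimes> b\<close> centralizes \<open>r\<close>, so both lie in one
  coset.\<close>

lemma coset_function_eq:
  assumes "\<phi> \<in> coset_functions G K" "a \<in> carrier G" "b \<in> carrier G" "conj_by G a r = conj_by G b r"
  shows "\<phi> a = \<phi> b"
proof -
  have "inv a \<otimes> b \<in> K"
    using assms by (simp add: centralizer_iff conj_by_mult flip: assms(4))
  then have "\<phi> (a \<otimes> (inv a \<otimes> b)) = \<phi> a"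
    using assms by (simp only: coset_functions_iff)
  then show ?thesis using assms by simp
qed

lemma coset_function_q:
  "\<phi> \<in> coset_functions G K \<Longrightarrow> a \<in> carrier G \<Longrightarrow> \<phi> (q (conj_by G a r)) = \<phi> a"
  by (rule coset_function_eq) (simp_all add: conj_by_q conj_by_r_in_C)

text \<open>Cosets of the centralizer are the fibres of conjugating \<open>r\<close>, which turns
  membership in the coset of \<open>g\<close> into an equation between conjugates of
  \<open>r\<close>.\<close>

lemma coset_delta_apply:
  assumes [simp]: "g \<in> carrier G"
  shows "coset_delta G K g v m = (if m \<in> carrier G \<and> conj_by G m r = conj_by G g r then v else 0)"
proof -
  let ?Q = "m \<in> carrier G \<and> conj_by G m r = conj_by G g r"
  have "m = g \<otimes> n \<longleftrightarrow> ?Q \<and> n = inv g \<otimes> m" if "n \<in> K" for n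
    using that by (auto simp: conj_by_mult conj_by_centralizer centralizer_in_G)
  then show ?thesis
    unfolding coset_delta_def sum_fun_apply single_def
    by (rule sum_if_unique[OF finite_centralizer]) (simp_all add: centralizer_iff conj_by_mult)
qed

lemma coset_delta_q: "c \<in> C \<Longrightarrow> d \<in> C \<Longrightarrow> coset_delta G K (q c) v (q d) = (if d = c then v else 0)"
  by (simp add: coset_delta_apply q_in_G conj_by_q)

text \<open>The \<delta> functions of cosets are orthogonal idempotents, and the representatives
  meet each coset once, so only the normalising factor remains.\<close>

lemma coset_integral_deltas:
  assumes "c \<in> C" "d \<in> C"
  shows "coset_integral G C r q (coset_delta G K (q c) 1 * coset_delta G K (q d) 1) =
    (if c = d then of_nat (card K) / of_nat (card (carrier G)) else 0)"
proof -
  have "(\<Sum>e\<in>C. coset_delta G K (q c) 1 (q e) * coset_delta G K (q d) 1 (q e)) =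
    (\<Sum>e\<in>C. if e = c then if c = d then 1 else 0 else (0 :: complex))"
    using assms by (intro sum.cong) (auto simp: coset_delta_q)
  then show ?thesis
    using assms by (simp add: coset_integral_def)
qed

text \<open>Left translation by \<open>q d\<close> carries the centralizer bijectively onto the
  fibre over \<open>d\<close>.\<close>

lemma card_conj_by_fibre:
  assumes "d \<in> C"
  shows "card {k \<in> carrier G. conj_by G k r = d} = card K"
proof -
  have [simp]: "q d \<in> carrier G"
    using assms by (simp add: q_in_G)
  have qd: "conj_by G (inv (q d)) d = r" "conj_by G (q d) r = d"
    using conj_by_inv_cancel(2)[of "q d" r] assms by (simp_all add: conj_by_q)
  have "bij_betw (\<lambda>n. q d \<otimes> n) K {k \<in> carrier G. conj_by G k r = d}"
  proof (rule bij_betw_byWitness[where f' = "\<lambda>k. inv (q d) \<otimes> k"])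
    show "(\<lambda>k. inv (q d) \<otimes> k) ` {k \<in> carrier G. conj_by G k r = d} \<subseteq> K"
    proof (intro image_subsetI, elim CollectE conjE)
      fix k assume k: "k \<in> carrier G" "conj_by G k r = d"
      have "conj_by G (inv (q d) \<otimes> k) r = r"
        using k(1) by (simp only: conj_by_mult inv_closed r_in_G \<open>q d \<in> carrier G\<close> k(2) qd)
      then show "inv (q d) \<otimes> k \<in> K" using k(1) by (simp add: centralizer_iff)
    qed
    show "(\<lambda>n. q d \<otimes> n) ` K \<subseteq> {k \<in> carrier G. conj_by G k r = d}"
      by (auto simp: centralizer_in_G conj_by_mult conj_by_centralizer qd)
  qed (simp_all add: centralizer_in_G)
  then show ?thesis
    by (rule bij_betw_same_card[symmetric])
qed

section \<open>The Hopf algebra H and its diagonal coaction\<close>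

lemma hmult_double_quotient:
  assumes "k \<in> K" "k' \<in> K" "h \<in> carrier G" "h' \<in> carrier G"
  shows "hmult (double_quotient G K) (single (k, h) 1) (single (k', h') 1) (j, m) =
    (if k = j \<and> k' = j \<and> m = h \<otimes> h' then 1 else 0)"
proof -
  have "hmult (double_quotient G K) (single (k, h) 1) (single (k', h') 1) (j, m) =
    (\<Sum>g\<in>K. \<Sum>a\<in>carrier G. \<Sum>b\<in>carrier G.
      if b = h' then if a = h then if g = k then
        if k = j \<and> k' = j \<and> m = h \<otimes> h' then 1 else 0 else 0 else 0 else 0)"
    unfolding double_quotient_def hopf.simps sum_fun_apply
    by (intro sum.cong refl) (auto simp: single_def)
  then show ?thesis
    using assms by simp
qed

lemma D_coaction_restrict:
  "D_coaction G (restrict_fun K) a ((f, h'), (k, h)) =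
    (if f \<in> carrier G \<and> k \<in> K \<and> h \<in> carrier G \<and> h' = conj_by G k h then a (f \<otimes> k, h) else 0)"
  by (auto simp: D_coaction_def id_tensor_def restrict_fun_def hcomult_apply centralizer_in_G)

lemma H_tensor_coaction_apply:
  fixes s :: "complex \<Rightarrow> 'v \<Rightarrow> 'v::ab_group_add"
  assumes "vector_space s"
  shows "tensor_coaction (double_quotient G K) s (carrier G \<times> carrier G) (D_coaction G (restrict_fun K)) R x ((f, h), (k, m)) =
    (if f \<in> carrier G \<and> h \<in> carrier G \<and> k \<in> K \<and> m \<in> carrier G
     then R (x (f \<otimes> k, conj_by G (inv k) h)) (k, inv (conj_by G (inv k) h) \<otimes> m) else 0)"
proof -
  interpret vector_space s by fact
  let ?B = "carrier G \<times> carrier G" and ?y = "conj_by G (inv k) h"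
  let ?Q = "f \<in> carrier G \<and> h \<in> carrier G \<and> k \<in> K \<and> m \<in> carrier G"
  let ?v = "\<lambda>b. s (single b 1 (f \<otimes> k, ?y)) (R (x b) (k, inv ?y \<otimes> m))"
  have "tensor_coaction (double_quotient G K) s ?B (D_coaction G (restrict_fun K)) R x ((f, h), (k, m)) =
    (\<Sum>b\<in>?B. \<Sum>p\<in>K \<times> carrier G. \<Sum>p'\<in>K \<times> carrier G.
      if p = (k, ?y) \<and> p' = (k, inv ?y \<otimes> m) \<and> ?Q then ?v b else 0)"
    unfolding tensor_coaction_def sum_fun_apply split
  proof (intro sum.cong refl)
    fix b p p'
    assume "p \<in> K \<times> carrier G" "p' \<in> K \<times> carrier G"
    then obtain k1 h1 k2 h2 where p: "p = (k1, h1)" "p' = (k2, h2)"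
      and mem [simp]: "k1 \<in> K" "k2 \<in> K" "h1 \<in> carrier G" "h2 \<in> carrier G"
      by auto
    have [simp]: "k1 \<in> carrier G" by (simp add: centralizer_in_G)
    \<comment> \<open>The coproduct fixes \<open>h1\<close> as the conjugate of \<open>h\<close> by
      \<open>inv k\<close>, and \<open>m = h1 \<otimes> h2\<close> can then be solved for
      \<open>h2\<close>, so at most one pair \<open>p\<close>, \<open>p'\<close>
      contributes.\<close>
    have iff: "(f \<in> carrier G \<and> h = conj_by G k1 h1) \<and> k1 = k \<and> k2 = k \<and> m = h1 \<otimes> h2 \<longleftrightarrow>
      p = (k, ?y) \<and> p' = (k, inv ?y \<otimes> m) \<and> ?Q"
    proof
      assume "(f \<in> carrier G \<and> h = conj_by G k1 h1) \<and> k1 = k \<and> k2 = k \<and> m = h1 \<otimes> h2"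
      with mem \<open>k1 \<in> carrier G\<close> show "p = (k, ?y) \<and> p' = (k, inv ?y \<otimes> m) \<and> ?Q"
        by (auto simp: p)
    next
      assume "p = (k, ?y) \<and> p' = (k, inv ?y \<otimes> m) \<and> ?Q"
      then have "k1 = k" "k2 = k" "h1 = ?y" "h2 = inv ?y \<otimes> m" ?Q
        by (auto simp: p)
      with \<open>k1 \<in> carrier G\<close> show "(f \<in> carrier G \<and> h = conj_by G k1 h1) \<and> k1 = k \<and> k2 = k \<and> m = h1 \<otimes> h2"
        by simp
    qed
    have "s (D_coaction G (restrict_fun K) (single b 1) ((f, h), p) *
        hmult (double_quotient G K) (single p 1) (single p' 1) (k, m)) (R (x b) p') =
      (if (f \<in> carrier G \<and> h = conj_by G k1 h1) \<and> k1 = k \<and> k2 = k \<and> m = h1 \<otimes> h2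
       then s (single b 1 (f \<otimes> k1, h1)) (R (x b) p') else 0)"
      by (simp add: p D_coaction_restrict hmult_double_quotient)
    also have "\<dots> = (if p = (k, ?y) \<and> p' = (k, inv ?y \<otimes> m) \<and> ?Q then ?v b else 0)"
      unfolding iff by (rule if_cong) (auto simp: p)
    finally show "s (D_coaction G (restrict_fun K) (single b 1) ((f, h), p) *
        hmult (double_quotient G K) (single p 1) (single p' 1) (k, m)) (R (x b) p') =
      (if p = (k, ?y) \<and> p' = (k, inv ?y \<otimes> m) \<and> ?Q then ?v b else 0)" .
  qed (simp_all add: double_quotient_def)
  also have "\<dots> = (\<Sum>b\<in>?B. if ?Q then ?v b else 0)"
    by (intro sum.cong refl sum_if_unique2[where a = "(k, ?y)" and b = "(k, inv ?y \<otimes> m)"])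
      (auto simp: centralizer_in_G)
  also have "\<dots> = (if ?Q then R (x (f \<otimes> k, ?y)) (k, inv ?y \<otimes> m) else 0)"
    by (cases ?Q) (simp add: sum_scale_single[OF assms] centralizer_in_G,
      simp only: if_False sum.neutral_const)
  finally show ?thesis .
qed

lemma hunit_double_quotient: "hunit (double_quotient G K) (k, m) = (if k \<in> K \<and> m = \<one> then 1 else 0)"
proof -
  have "hunit (double_quotient G K) (k, m) = (\<Sum>g\<in>K. if g = k then if m = \<one> then 1 else 0 else 0)"
    unfolding double_quotient_def hopf.simps sum_fun_apply by (intro sum.cong) (auto simp: single_def)
  then show ?thesis by simp
qed

end

section \<open>Induction from the centralizer\<close>

locale induced_comodule =
  class_section G C r q + subgroup_representation G "centralizer G r" s \<pi>
  for G :: "('g, 'z) monoid_scheme" (structure) and C r q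
    and s :: "complex \<Rightarrow> 'v \<Rightarrow> 'v::ab_group_add" and \<pi> :: "'g \<Rightarrow> 'v \<Rightarrow> 'v"
begin

section \<open>The invariants E in coordinates\<close>

lemma V_coaction_apply: "V_coaction G r \<pi> v (k, h) = (if k \<in> K \<and> h = r then \<pi> k v else 0)"
proof -
  have "V_coaction G r \<pi> v (k, h) = (\<Sum>g\<in>K. if g = k then if h = r then \<pi> k v else 0 else 0)"
    unfolding V_coaction_def sum_fun_apply by (intro sum.cong) (auto simp: single_def)
  then show ?thesis by simp
qed

text \<open>The coaction on V lives in the single degree \<open>r\<close>, which the degree of the
  first factor must cancel to match the unit of H. This forces \<open>h = inv r\<close>, and the
  component at \<open>k\<close> is then equivariance under \<open>k\<close>.\<close>

lemma E_V_iff: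
  "x \<in> E_V G r s \<pi> \<longleftrightarrow> x \<in> supported (carrier G \<times> {inv r}) \<and>
    (\<forall>f\<in>carrier G. \<forall>k\<in>K. \<pi> k (x (f \<otimes> k, inv r)) = x (f, inv r))"
proof -
  let ?T = "tensor_coaction (double_quotient G K) s (carrier G \<times> carrier G)
    (D_coaction G (restrict_fun K)) (V_coaction G r \<pi>) x"
  have scale_hunit: "s (hunit (double_quotient G K) (k, m)) v = (if k \<in> K \<and> m = \<one> then v else 0)" for k m v
    by (simp add: hunit_double_quotient)
  have unfold: "x \<in> E_V G r s \<pi> \<longleftrightarrow> x \<in> supported (carrier G \<times> carrier G) \<and>
      (\<forall>f h k m. ?T ((f, h), (k, m)) = (if k \<in> K \<and> m = \<one> then x (f, h) else 0))"
    unfolding E_V_def H_invariants_def Let_def invariants_def hbasis_dual_double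
    by (simp only: mem_Collect_eq fun_eq_pairs_iff split scale_hunit)
  have T: "?T ((f, h), (k, m)) = (if f \<in> carrier G \<and> h \<in> carrier G \<and> k \<in> K \<and> m \<in> carrier G
      \<and> inv (conj_by G (inv k) h) \<otimes> m = r then \<pi> k (x (f \<otimes> k, conj_by G (inv k) h)) else 0)" for f h k m
    by (simp add: H_tensor_coaction_apply[OF vs] V_coaction_apply)
  show ?thesis
  proof
    assume "x \<in> E_V G r s \<pi>"
    then have supp: "x \<in> supported (carrier G \<times> carrier G)"
      and inv: "?T ((f, h), (k, m)) = (if k \<in> K \<and> m = \<one> then x (f, h) else 0)" for f h k m
      unfolding unfold by blast+
    have "x (f, h) = 0" if "f \<in> carrier G" "h \<in> carrier G" "h \<noteq> inv r" for f h
    proof -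
      \<comment> \<open>Both sides are compared at \<open>k = \<one>\<close> and
        \<open>m = \<one>\<close>: the coaction side vanishes because its degree condition would
        read \<open>inv h = r\<close>.\<close>
      have "inv h \<noteq> r" using that by auto
      then show ?thesis using inv[of f h \<one> \<one>] that by (simp add: T)
    qed
    with supp have "x \<in> supported (carrier G \<times> {inv r})"
      by (auto simp: supported_def)
    moreover have "\<pi> k (x (f \<otimes> k, inv r)) = x (f, inv r)" if "f \<in> carrier G" "k \<in> K" for f k
      using inv[of f "inv r" k \<one>] that by (simp add: T conj_by_centralizer)
    ultimately show "x \<in> supported (carrier G \<times> {inv r}) \<and>
      (\<forall>f\<in>carrier G. \<forall>k\<in>K. \<pi> k (x (f \<otimes> k, inv r)) = x (f, inv r))" by blast
  next
    assume R: "x \<in> supported (carrier G \<times> {inv r}) \<and>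
      (\<forall>f\<in>carrier G. \<forall>k\<in>K. \<pi> k (x (f \<otimes> k, inv r)) = x (f, inv r))"
    then have supp: "x (f, h) = 0" if "f \<notin> carrier G \<or> h \<noteq> inv r" for f h
      using that unfolding supported_def by simp
    have equivariant: "\<pi> k (x (f \<otimes> k, inv r)) = x (f, inv r)" if "f \<in> carrier G" "k \<in> K" for f k
      using R that by blast
    have "?T ((f, h), (k, m)) = (if k \<in> K \<and> m = \<one> then x (f, h) else 0)" for f h k m
    proof (cases "f \<in> carrier G \<and> k \<in> K \<and> m \<in> carrier G \<and> h \<in> carrier G")
      case True
      then have [simp]: "f \<in> carrier G" "k \<in> K" "m \<in> carrier G" "h \<in> carrier G" by auto
      show ?thesis
      proof (cases "h = inv r")
        case True
        have "r \<otimes> m = r \<longleftrightarrow> m = \<one>" by simp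
        with True show ?thesis
          by (simp add: T conj_by_centralizer equivariant)
      next
        case False
        \<comment> \<open>The support condition is needed at the conjugated index too; conjugation
          by \<open>k\<close> fixes \<open>inv r\<close>, so that index cannot be
          \<open>inv r\<close> either.\<close>
        have "conj_by G (inv k) h \<noteq> inv r"
        proof
          assume eq: "conj_by G (inv k) h = inv r"
          have "h = conj_by G k (conj_by G (inv k) h)" by simp
          then have "h = inv r" unfolding eq by (simp add: conj_by_centralizer)
          with False show False ..
        qed
        with False show ?thesis
          by (simp add: T supp)
      qed
    next
      case False
      have "x (f, h) = 0 \<or> f \<in> carrier G \<and> h \<in> carrier G"
        using supp[of f h] by (cases "f \<in> carrier G \<and> h = inv r") auto
      with False show ?thesis by (auto simp: T)
    qed
    moreover have "x \<in> supported (carrier G \<times> carrier G)"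
      using R supported_inv_r by blast
    ultimately show "x \<in> E_V G r s \<pi>" unfolding unfold by blast
  qed
qed

text \<open>The equation \<open>a = q c \<otimes> inv g\<close> has one solution: \<open>c\<close>
  is the conjugate of \<open>r\<close> by \<open>a\<close>, and then \<open>g = kappa a\<close>.
  Coset invariance replaces the value at the representative by \<open>\<phi> a\<close>.\<close>

lemma E_V_iso_apply:
  assumes "\<phi> \<in> coset_functions G K"
  shows "E_V_iso G C r q \<pi> \<phi> (a, b) = (if a \<in> carrier G \<and> b = inv r then \<pi> (kappa a) (\<phi> a) else 0)"
proof -
  let ?Q = "a \<in> carrier G \<and> b = inv r"
  have "E_V_iso G C r q \<pi> \<phi> (a, b) =
    (if ?Q then \<pi> (kappa a) (\<phi> (q (conj_by G a r))) else 0)"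
    unfolding E_V_iso_def sum_fun_apply single_def
  proof (rule sum_if_unique2)
    fix c g assume [simp]: "c \<in> C" "g \<in> K"
    have [simp]: "q c \<in> carrier G" "g \<in> carrier G" by (simp_all add: q_in_G)
    show "(a, b) = (q c \<otimes> inv g, inv r) \<longleftrightarrow> ?Q \<and> c = conj_by G a r \<and> g = kappa a"
    proof
      assume eq: "(a, b) = (q c \<otimes> inv g, inv r)"
      then have a: "a = q c \<otimes> inv g" by simp
      have "conj_by G a r = c"
        by (simp add: a conj_by_mult conj_by_centralizer conj_by_q)
      then have "kappa a = g"
        by (simp add: kappa_def a inv_mult_group m_assoc)
      with eq \<open>conj_by G a r = c\<close> show "?Q \<and> c = conj_by G a r \<and> g = kappa a" by auto
    next
      assume Q: "?Q \<and> c = conj_by G a r \<and> g = kappa a"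
      then have "q c = a \<otimes> g" by (simp add: mult_kappa)
      with Q show "(a, b) = (q c \<otimes> inv g, inv r)" by (simp add: m_assoc)
    qed
  qed (auto simp: conj_by_r_in_C)
  then show ?thesis
    using assms by (simp add: coset_function_q)
qed

text \<open>For \<open>c\<close> the conjugate of \<open>r\<close> by \<open>f \<otimes> m\<close>,
  the cocycle \<open>zeta G q c (inv f)\<close> is a quotient of two values of \<open>kappa\<close>.
  In this form iterated coactions telescope.\<close>

lemma coset_V_coaction_apply:
  assumes "\<phi> \<in> coset_functions G K"
  shows "coset_V_coaction G C r q \<pi> \<phi> ((f, h), m) =
    (if f \<in> carrier G \<and> m \<in> carrier G \<and> h = conj_by G m (inv r)
     then \<pi> (inv (kappa m) \<otimes> kappa (f \<otimes> m)) (\<phi> (f \<otimes> m)) else 0)"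
proof -
  let ?Q = "f \<in> carrier G \<and> m \<in> carrier G \<and> h = conj_by G m (inv r)"
  let ?P = "\<lambda>c f'. f' = f \<and> h = conj_by G (inv f') (inv c) \<and> m \<in> carrier G \<and>
    conj_by G m r = conj_by G (inv f') c"
  \<comment> \<open>Solving the last equation of \<open>?P\<close> for \<open>c\<close> when
    \<open>f' = f\<close> gives this class element.\<close>
  let ?c = "conj_by G (f \<otimes> m) r"
  have "coset_V_coaction G C r q \<pi> \<phi> ((f, h), m) = (\<Sum>c\<in>C. \<Sum>f'\<in>carrier G.
    if ?P c f' then \<pi> (zeta G q c (inv f')) (\<phi> (q c)) else 0)"
    unfolding coset_V_coaction_def sum_fun_apply
  proof (intro sum.cong refl)
    fix c f' assume [simp]: "c \<in> C" "f' \<in> carrier G"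
    have [simp]: "c \<in> carrier G" by (simp add: C_subset)
    then show "basis_tensor (f', conj_by G (inv f') (inv c)) (coset_delta G K (q (conj_by G (inv f') c))
        (\<pi> (zeta G q c (inv f')) (\<phi> (q c)))) ((f, h), m) =
      (if ?P c f' then \<pi> (zeta G q c (inv f')) (\<phi> (q c)) else 0)"
      by (cases "f = f'") (simp_all add: basis_tensor_def coset_delta_apply q_in_G conj_by_q)
  qed
  also have "\<dots> = (if ?Q then \<pi> (zeta G q ?c (inv f)) (\<phi> (q ?c)) else 0)"
  proof (rule sum_if_unique2)
    fix c f' assume [simp]: "c \<in> C" "f' \<in> carrier G"
    have [simp]: "c \<in> carrier G" by (simp add: C_subset)
    show "?P c f' \<longleftrightarrow> ?Q \<and> c = ?c \<and> f' = f"
    proof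
      assume P: "?P c f'"
      moreover from P \<open>f' \<in> carrier G\<close> have "f \<in> carrier G" by blast
      ultimately have "c = conj_by G f (conj_by G m r)" by simp
      with P \<open>f \<in> carrier G\<close> show "?Q \<and> c = ?c \<and> f' = f"
        by (auto simp: conj_by_mult simp flip: inv_conj_by)
    qed (auto simp: conj_by_mult inv_conj_by)
  qed (auto simp: conj_by_r_in_C)
  also have "\<dots> = (if ?Q then \<pi> (inv (kappa m) \<otimes> kappa (f \<otimes> m)) (\<phi> (f \<otimes> m)) else 0)"
  proof (intro if_cong refl)
    assume ?Q
    then have [simp]: "f \<in> carrier G" "m \<in> carrier G" by auto
    have "zeta G q ?c (inv f) = inv (kappa m) \<otimes> kappa (f \<otimes> m)"
      by (simp add: zeta_def kappa_def conj_by_mult m_assoc inv_mult_group q_in_G conj_by_r_in_C)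
    then show "\<pi> (zeta G q ?c (inv f)) (\<phi> (q ?c)) = \<pi> (inv (kappa m) \<otimes> kappa (f \<otimes> m)) (\<phi> (f \<otimes> m))"
      using assms by (simp add: coset_function_q)
  qed
  finally show ?thesis .
qed

section \<open>Left coactions on the induced space and on E\<close>

lemma coset_functions_subspace:
  fixes \<phi> \<psi> :: "'g \<Rightarrow> 'v"
  shows "(0 :: 'g \<Rightarrow> 'v) \<in> coset_functions G K"
    and "\<phi> \<in> coset_functions G K \<Longrightarrow> \<psi> \<in> coset_functions G K \<Longrightarrow> \<phi> + \<psi> \<in> coset_functions G K"
    and "\<phi> \<in> coset_functions G K \<Longrightarrow> fscale s a \<phi> \<in> coset_functions G K"
  by (auto simp: coset_functions_iff supported_def fscale_def)

text \<open>Replacing \<open>m\<close> by \<open>m \<otimes> n\<close> multiplies both values of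
  \<open>kappa\<close> by \<open>inv n\<close> on the left, which cancels in their quotient.\<close>

lemma coset_V_coaction_closed:
  assumes \<phi>: "\<phi> \<in> coset_functions G K"
  shows "(\<lambda>m. coset_V_coaction G C r q \<pi> \<phi> ((f, h), m)) \<in> coset_functions G K"
proof -
  have "coset_V_coaction G C r q \<pi> \<phi> ((f, h), m \<otimes> n) = coset_V_coaction G C r q \<pi> \<phi> ((f, h), m)"
    if [simp]: "m \<in> carrier G" "n \<in> K" for m n
  proof -
    have "inv (kappa (m \<otimes> n)) \<otimes> kappa (f \<otimes> (m \<otimes> n)) = inv (kappa m) \<otimes> kappa (f \<otimes> m)"
      "\<phi> (f \<otimes> (m \<otimes> n)) = \<phi> (f \<otimes> m)" if [simp]: "f \<in> carrier G"
    proof -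
      have assoc: "f \<otimes> (m \<otimes> n) = f \<otimes> m \<otimes> n"
        by (simp add: m_assoc)
      have "kappa (f \<otimes> (m \<otimes> n)) = inv n \<otimes> kappa (f \<otimes> m)"
        by (simp add: assoc kappa_mult)
      then show "inv (kappa (m \<otimes> n)) \<otimes> kappa (f \<otimes> (m \<otimes> n)) = inv (kappa m) \<otimes> kappa (f \<otimes> m)"
        by (simp add: kappa_mult inv_mult_group m_assoc)
      show "\<phi> (f \<otimes> (m \<otimes> n)) = \<phi> (f \<otimes> m)"
        using \<phi> by (simp add: assoc coset_functions_iff)
    qed
    then show ?thesis
      by (simp add: coset_V_coaction_apply[OF \<phi>] conj_by_mult conj_by_centralizer)
  qed
  then show ?thesis
    by (auto simp: coset_functions_iff supported_def coset_V_coaction_apply[OF \<phi>])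
qed

lemma left_comodule_coset_V:
  "left_comodule (dual_double G) s (coset_functions G K) (coset_V_coaction G C r q \<pi>)"
proof (rule left_comoduleI[OF vs coset_functions_subspace _ _ coset_V_coaction_closed])
  fix \<phi> :: "'g \<Rightarrow> 'v"
  assume \<phi>: "\<phi> \<in> coset_functions G K"
  show "coset_V_coaction G C r q \<pi> (\<phi> + \<psi>) ((f, h), m) =
      coset_V_coaction G C r q \<pi> \<phi> ((f, h), m) + coset_V_coaction G C r q \<pi> \<psi> ((f, h), m)"
    if "\<psi> \<in> coset_functions G K" for \<psi> f h m
    using \<phi> that by (simp add: coset_V_coaction_apply coset_functions_subspace rep_add)
  show "coset_V_coaction G C r q \<pi> (fscale s a \<phi>) ((f, h), m) = s a (coset_V_coaction G C r q \<pi> \<phi> ((f, h), m))"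
    for a f h m
    using \<phi> by (simp add: coset_V_coaction_apply coset_functions_subspace) (simp add: fscale_def rep_scale)
  show "coset_V_coaction G C r q \<pi> \<phi> ((f, h), m) = 0" if "f \<notin> carrier G \<or> h \<notin> carrier G" for f h m
    using \<phi> that by (auto simp: coset_V_coaction_apply)
  \<comment> \<open>The \<open>kappa\<close> factors of the intermediate point
    \<open>k \<otimes> m\<close> cancel, so the two successive cocycle values multiply to the one
    for \<open>f \<otimes> k\<close>.\<close>
  show "coset_V_coaction G C r q \<pi> (\<lambda>m'. coset_V_coaction G C r q \<pi> \<phi> ((f, h'), m')) ((k, h), m) =
    (if f \<in> carrier G \<and> k \<in> carrier G \<and> h \<in> carrier G \<and> h' = conj_by G k h
     then coset_V_coaction G C r q \<pi> \<phi> ((f \<otimes> k, h), m) else 0)" for f h' k h m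
    unfolding coset_V_coaction_apply[OF coset_V_coaction_closed[OF \<phi>]]
    unfolding coset_V_coaction_apply[OF \<phi>]
    by (auto simp: rep_rep m_assoc conj_by_mult)
  show "(\<Sum>h\<in>carrier G. coset_V_coaction G C r q \<pi> \<phi> ((\<one>, h), m)) = \<phi> m" for m
  proof -
    have "(\<Sum>h\<in>carrier G. coset_V_coaction G C r q \<pi> \<phi> ((\<one>, h), m)) =
      (\<Sum>h\<in>carrier G. if h = conj_by G m (inv r) then \<phi> m else 0)"
      using \<phi> by (intro sum.cong) (auto simp: coset_V_coaction_apply coset_functions_iff supported_def)
    also have "\<dots> = \<phi> m"
      using \<phi> by (cases "m \<in> carrier G") (auto simp: coset_functions_iff supported_def)
    finally show ?thesis .
  qed
qed auto

text \<open>Right translation by the centralizer commutes with the left translation in the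
  coproduct, and conjugation by the centralizer fixes the degree \<open>inv r\<close>.\<close>

lemma left_comodule_E_V: "left_comodule (dual_double G) s (E_V G r s \<pi>) (comult_first G s)"
proof (rule left_comodule_comult_first[OF vs])
  show "E_V G r s \<pi> \<subseteq> supported (carrier G \<times> carrier G)"
    using supported_inv_r by (auto simp: E_V_iff)
  fix x f h
  assume x: "x \<in> E_V G r s \<pi>"
  have "\<pi> j (comult_first G s x ((f, h), (k \<otimes> j, inv r))) = comult_first G s x ((f, h), (k, inv r))"
    if [simp]: "k \<in> carrier G" "j \<in> K" for k j
  proof -
    have "\<pi> j (x (f \<otimes> k \<otimes> j, inv r)) = x (f \<otimes> k, inv r)" if "f \<in> carrier G"
      using x that unfolding E_V_iff by simp
    then show ?thesis
      by (simp add: comult_first_apply[OF vs] conj_by_mult conj_by_centralizer m_assoc)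
  qed
  then show "(\<lambda>m. comult_first G s x ((f, h), m)) \<in> E_V G r s \<pi>"
    using x by (auto simp: E_V_iff supported_def comult_first_apply[OF vs])
qed (auto simp: E_V_iff supported_def fscale_def rep_add rep_scale)

lemma E_V_iso_closed: "\<phi> \<in> coset_functions G K \<Longrightarrow> E_V_iso G C r q \<pi> \<phi> \<in> E_V G r s \<pi>"
  by (auto simp: E_V_iff supported_def E_V_iso_apply kappa_mult rep_rep coset_functions_iff)

text \<open>Elements of E are supported in degree \<open>inv r\<close> and equivariant along cosets,
  so twisting their values by the inverse of \<open>kappa a\<close> makes them constant on cosets.
  This undoes the twist in \<open>E_V_iso\<close> and provides the inverse.\<close>

lemma E_V_iso: "left_comodule_iso (dual_double G)
   s (coset_functions G K) (coset_V_coaction G C r q \<pi>)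
   s (E_V G r s \<pi>) (comult_first G s) (E_V_iso G C r q \<pi>)"
proof -
  let ?inverse = "\<lambda>x a. if a \<in> carrier G then \<pi> (inv (kappa a)) (x (a, inv r)) else 0"
  have inverse_closed: "?inverse x \<in> coset_functions G K" if x: "x \<in> E_V G r s \<pi>" for x
  proof -
    have "\<pi> (inv (kappa (a \<otimes> k))) (x (a \<otimes> k, inv r)) = \<pi> (inv (kappa a)) (x (a, inv r))"
      if [simp]: "a \<in> carrier G" "k \<in> K" for a k
    proof -
      have "\<pi> k (x (a \<otimes> k, inv r)) = x (a, inv r)"
        using x unfolding E_V_iff by simp
      then show ?thesis
        by (simp add: kappa_mult inv_mult_group flip: rep_rep)
    qed
    then show ?thesis by (auto simp: coset_functions_iff supported_def)
  qed
  have "bij_betw (E_V_iso G C r q \<pi>) (coset_functions G K) (E_V G r s \<pi>)"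
  proof (rule bij_betw_byWitness[where f' = ?inverse])
    show "\<forall>\<phi>\<in>coset_functions G K. ?inverse (E_V_iso G C r q \<pi> \<phi>) = \<phi>"
      by (auto simp: E_V_iso_apply fun_eq_iff) (auto simp: coset_functions_iff supported_def)
    show "\<forall>x\<in>E_V G r s \<pi>. E_V_iso G C r q \<pi> (?inverse x) = x"
      by (intro ballI fun_eq_pairI) (auto simp: E_V_iso_apply inverse_closed E_V_iff supported_def)
  qed (auto simp: E_V_iso_closed inverse_closed)
  moreover have "id_tensor (E_V_iso G C r q \<pi>) (coset_V_coaction G C r q \<pi> \<phi>) = comult_first G s (E_V_iso G C r q \<pi> \<phi>)"
    if \<phi>: "\<phi> \<in> coset_functions G K" for \<phi>
  proof (rule fun_eq_pairI)
    fix b p :: "'g \<times> 'g"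
    obtain f h' k h where b: "b = (f, h')" and p: "p = (k, h)" by (cases b, cases p)
    show "id_tensor (E_V_iso G C r q \<pi>) (coset_V_coaction G C r q \<pi> \<phi>) (b, p) =
      comult_first G s (E_V_iso G C r q \<pi> \<phi>) (b, p)"
      unfolding b p id_tensor_def split E_V_iso_apply[OF coset_V_coaction_closed[OF \<phi>]]
      unfolding comult_first_apply[OF vs] E_V_iso_apply[OF \<phi>] coset_V_coaction_apply[OF \<phi>]
      by (auto simp: rep_rep)
  qed
  ultimately show ?thesis
    unfolding left_comodule_iso_def left_comodule_hom_def
    by (auto simp: left_comodule_E_V left_comodule_coset_V E_V_iso_closed E_V_iso_apply coset_functions_subspace
        rep_add intro!: ext) (auto simp: fscale_def rep_scale E_V_iso_apply coset_functions_subspace)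
qed

end

section \<open>The embedding\<close>

text \<open>The diagonal coaction touches the second factor only through that factor's own coaction,
  so a linear map intertwining these coactions also intertwines the diagonal ones.\<close>

lemma invariants_comp:
  assumes "Vector_Spaces.linear s s' \<iota>"
    and R: "\<And>v. R' (\<iota> v) = \<iota> \<circ> R v"
    and x: "x \<in> invariants A s B (tensor_coaction A s B \<sigma> R)"
  shows "\<iota> \<circ> x \<in> invariants A s' B (tensor_coaction A s' B \<sigma> R')"
proof -
  interpret \<iota>: Vector_Spaces.linear s s' \<iota> by fact
  have "tensor_coaction A s' B \<sigma> R' (\<iota> \<circ> x) p = \<iota> (tensor_coaction A s B \<sigma> R x p)" for p
    unfolding tensor_coaction_def sum_fun_apply comp_apply R \<iota>.sum
    by (intro sum.cong refl) (simp add: \<iota>.scale split: prod.split)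
  moreover have "tensor_coaction A s B \<sigma> R x (b, k) = s (hunit A k) (x b)" for b k
    using x by (simp add: invariants_def)
  ultimately show ?thesis
    using x by (auto simp: invariants_def supported_def \<iota>.scale fun_eq_iff)
qed

text \<open>Containment of V in the pushout of W is encoded by an injective linear map intertwining
  the two coactions of H.\<close>

locale comodule_inclusion =
  V: induced_comodule G C r q sV \<pi> + W: crossed_comodule G sW act \<rho> gr
  for G :: "('g, 'z) monoid_scheme" (structure) and C r q
    and sV :: "complex \<Rightarrow> 'v \<Rightarrow> 'v::ab_group_add" and \<pi>
    and sW :: "complex \<Rightarrow> 'w \<Rightarrow> 'w::ab_group_add" and act \<rho> gr +
  fixes \<iota> :: "'v \<Rightarrow> 'w"
  assumes linear_\<iota>: "Vector_Spaces.linear sV sW \<iota>" and inj_\<iota>: "inj \<iota>"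
    and H_pushout_\<iota>: "\<And>v. H_pushout G r sW \<rho> (\<iota> v) = \<iota> \<circ> V_coaction G r \<pi> v"
begin

sublocale \<iota>: Vector_Spaces.linear sV sW \<iota> by (rule linear_\<iota>)

text \<open>Comparing the \<open>\<delta>\<^sub>g \<otimes> r\<close> components of the two coactions at \<open>g = 1\<close> shows that \<open>\<iota> v\<close> has
  degree-\<open>r\<close> part \<open>\<iota> v\<close>; then the components at \<open>g \<in> C\<^sub>G\<close> compare the actions.\<close>
lemma act_\<iota>:
  assumes "k \<in> centralizer G r"
  shows "act k (\<iota> v) = \<iota> (\<pi> k v)"
proof -
  obtain u where u: "\<And>g d. \<rho> (\<iota> v) (g, d) = (if g \<in> carrier G \<and> d \<in> carrier G then act g (u d) else 0)"
    using W.coaction_decomposition[of "\<iota> v"] by metis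
  have "act g (u r) = \<iota> (\<pi> g v)" if [simp]: "g \<in> centralizer G r" for g
  proof -
    \<comment> \<open>Restriction to the centralizer leaves the components at its own elements
      unchanged.\<close>
    have "H_pushout G r sW \<rho> (\<iota> v) (g, r) = \<rho> (\<iota> v) (g, r)"
      by (simp add: H_pushout_def pushout_def tensor_id_apply restrict_fun_def sum_scale_single[OF W.vs])
    then show ?thesis
      by (simp add: u H_pushout_\<iota> V.V_coaction_apply)
  qed
  from this[of \<one>] this[OF assms] show ?thesis by simp
qed

lemma E_V_subset_E_W: "(\<lambda>x. \<iota> \<circ> x) ` E_V G r sV \<pi> \<subseteq> E_W G r sW \<rho>"
  unfolding E_V_def E_W_def H_invariants_def Let_def
  using invariants_comp[where R = "V_coaction G r \<pi>" and R' = "H_pushout G r sW \<rho>", OF linear_\<iota> H_pushout_\<iota>]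
  by blast

section \<open>The covariant integral formula\<close>

lemma cov_embedding_apply:
  "cov_embedding G C r q sW act \<iota> \<phi> m = (if m \<in> carrier G \<and> inv m \<in> C
    then sW (of_nat (card (centralizer G r)) / of_nat (card (carrier G))) (act (q (inv m)) (\<iota> (\<phi> (q (inv m))))) else 0)"
proof -
  let ?n = "of_nat (card (centralizer G r)) / of_nat (card (carrier G)) :: complex"
  have cov_q: "cov G C r q act (\<iota> \<circ> \<phi>) (q c) = act (q c) (\<iota> (\<phi> (q c)))" if "c \<in> C" for c
  proof -
    have "cov G C r q act (\<iota> \<circ> \<phi>) (q c) = (\<Sum>d\<in>C. if d = c then act (q c) (\<iota> (\<phi> (q c))) else 0)"
      unfolding cov_def sum_fun_apply using that by (intro sum.cong) (auto simp: V.coset_delta_q)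
    then show ?thesis using that by simp
  qed
  \<comment> \<open>Orthogonality of the coset \<delta> functions leaves one summand of the
    covariant tensor, scaled by the normalising factor \<open>?n\<close>.\<close>
  have integral: "integrate_against G C r q sW (cov G C r q act (\<iota> \<circ> \<phi>)) (coset_delta G (centralizer G r) (q c) 1) =
    sW ?n (act (q c) (\<iota> (\<phi> (q c))))" if "c \<in> C" for c
  proof -
    have "integrate_against G C r q sW (cov G C r q act (\<iota> \<circ> \<phi>)) (coset_delta G (centralizer G r) (q c) 1) =
      (\<Sum>d\<in>C. if d = c then sW ?n (act (q c) (\<iota> (\<phi> (q c)))) else 0)"
      unfolding integrate_against_def using that
      by (intro sum.cong) (auto simp: V.coset_integral_deltas cov_q)
    then show ?thesis using that by simp
  qed
  have "cov_embedding G C r q sW act \<iota> \<phi> m =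
    (\<Sum>c\<in>C. if m = inv c then sW ?n (act (q c) (\<iota> (\<phi> (q c)))) else 0)"
    unfolding cov_embedding_def sum_fun_apply by (intro sum.cong) (auto simp: single_def integral)
  also have "\<dots> = (if m \<in> carrier G \<and> inv m \<in> C
    then sW ?n (act (q (inv m)) (\<iota> (\<phi> (q (inv m))))) else 0)"
  proof (rule sum_if_unique)
    fix c assume "c \<in> C"
    then have "c \<in> carrier G" by (rule V.C_subset)
    with \<open>c \<in> C\<close> show "m = inv c \<longleftrightarrow> (m \<in> carrier G \<and> inv m \<in> C) \<and> c = inv m" by auto
  qed auto
  finally show ?thesis .
qed

text \<open>Linearity of \<open>\<iota>\<close> and of the action lets the scalar
  \<open>f (q c)\<close> pass outside.\<close>

lemma cov_embedding_pure_tensor: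
  "cov_embedding G C r q sW act \<iota> (pure_tensor sV f v) =
    fscale sW (of_nat (card (centralizer G r)) / of_nat (card (carrier G)))
      (\<Sum>c\<in>C. pure_tensor sW (single (inv c) (f (q c))) (act (q c) (\<iota> v)))"
proof
  fix m
  have "(\<Sum>c\<in>C. pure_tensor sW (single (inv c) (f (q c))) (act (q c) (\<iota> v)) m) =
    (\<Sum>c\<in>C. if m = inv c then sW (f (q c)) (act (q c) (\<iota> v)) else 0)"
    by (intro sum.cong) (auto simp: pure_tensor_def single_def)
  also have "\<dots> = (if m \<in> carrier G \<and> inv m \<in> C
    then sW (f (q (inv m))) (act (q (inv m)) (\<iota> v)) else 0)"
  proof (rule sum_if_unique)
    fix c assume "c \<in> C"
    then have "c \<in> carrier G" by (rule V.C_subset)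
    with \<open>c \<in> C\<close> show "m = inv c \<longleftrightarrow> (m \<in> carrier G \<and> inv m \<in> C) \<and> c = inv m" by auto
  qed auto
  finally show "cov_embedding G C r q sW act \<iota> (pure_tensor sV f v) m =
    fscale sW (of_nat (card (centralizer G r)) / of_nat (card (carrier G)))
      (\<Sum>c\<in>C. pure_tensor sW (single (inv c) (f (q c))) (act (q c) (\<iota> v))) m"
    by (simp add: cov_embedding_apply fscale_def sum_fun_apply pure_tensor_def \<iota>.scale W.rep_scale V.q_in_G)
qed

section \<open>The inclusion followed by averaging\<close>

lemma av_E_V_iso:
  assumes \<phi>: "\<phi> \<in> coset_functions G (centralizer G r)"
  shows "av G sW \<rho> (\<iota> \<circ> E_V_iso G C r q \<pi> \<phi>) = E'_iso G act (cov_embedding G C r q sW act \<iota> \<phi>)"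
proof (rule fun_eq_pairI)
  fix f h
  let ?N = "of_nat (card (carrier G)) :: complex"
  show "av G sW \<rho> (\<iota> \<circ> E_V_iso G C r q \<pi> \<phi>) (f, h) =
    E'_iso G act (cov_embedding G C r q sW act \<iota> \<phi>) (f, h)"
  proof (cases "f \<in> carrier G \<and> h \<in> carrier G")
    case True
    then have [simp]: "f \<in> carrier G" "h \<in> carrier G" by auto
    \<comment> \<open>This class element comes from the other side: \<open>E'_iso\<close> at
      \<open>(f, h)\<close> evaluates the formula at \<open>conj_by G f h\<close>, whose inverse is
      \<open>c\<close>.\<close>
    define c where "c = conj_by G f (inv h)"
    have c_iff: "c \<in> C \<longleftrightarrow> inv h \<in> C" by (simp add: c_def)
    let ?X = "act (inv f \<otimes> q c) (\<iota> (\<phi> (q c)))"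
    have "act k (\<iota> (E_V_iso G C r q \<pi> \<phi> (f \<otimes> k, conj_by G (inv k) h))) =
      (if conj_by G k r = inv h then ?X else 0)" if k [simp]: "k \<in> carrier G" for k
    proof (cases "conj_by G k r = inv h")
      case True
      have "h = conj_by G k (inv r)"
        using arg_cong[OF True, of "\<lambda>x. inv x"] by (simp add: V.inv_conj_by)
      then have "conj_by G (inv k) h = inv r" by simp
      moreover have "conj_by G (f \<otimes> k) r = c"
        by (simp add: V.conj_by_mult True c_def)
      \<comment> \<open>\<open>f \<otimes> k\<close> lies in the coset of \<open>q c\<close>. The
        outer action by \<open>k\<close> combines with the twist \<open>kappa\<close> to
        \<open>inv f \<otimes> q c\<close>, which does not involve \<open>k\<close>.\<close>
      then have "q c = f \<otimes> k \<otimes> V.kappa (f \<otimes> k)" "\<phi> (q c) = \<phi> (f \<otimes> k)"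
        using V.mult_kappa[of "f \<otimes> k"] V.coset_function_q[OF \<phi>, of "f \<otimes> k"] by simp_all
      moreover from this have "k \<otimes> V.kappa (f \<otimes> k) = inv f \<otimes> q c"
        by (simp add: V.m_assoc)
      ultimately show ?thesis
        using True by (simp add: V.E_V_iso_apply[OF \<phi>] W.rep_rep flip: act_\<iota>)
    next
      case False
      \<comment> \<open>Off the fibre, the element of E is evaluated outside its support.\<close>
      have "conj_by G (inv k) h \<noteq> inv r"
      proof
        assume eq: "conj_by G (inv k) h = inv r"
        have "inv h = inv (conj_by G k (conj_by G (inv k) h))" by simp
        also have "\<dots> = conj_by G k r" unfolding eq by (simp add: V.inv_conj_by)
        finally show False using False by simp
      qed
      with False show ?thesis
        by (simp add: V.E_V_iso_apply[OF \<phi>])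
    qed
    then have "(\<Sum>k\<in>carrier G. act k (\<iota> (E_V_iso G C r q \<pi> \<phi> (f \<otimes> k, conj_by G (inv k) h)))) =
      (\<Sum>k | k \<in> carrier G \<and> conj_by G k r = inv h. ?X)"
      by (simp add: sum.inter_filter)
    \<comment> \<open>The summand is constant on the fibre, so only the size of the fibre matters:
      that of the centralizer, or zero if \<open>inv h\<close> lies outside the class.\<close>
    also have "\<dots> = sW (of_nat (card {k \<in> carrier G. conj_by G k r = inv h})) ?X"
      by (rule W.sum_constant_scale)
    also have "\<dots> = (if c \<in> C then sW (of_nat (card (centralizer G r))) ?X else 0)"
    proof (cases "inv h \<in> C")
      case True
      then show ?thesis by (simp add: c_iff V.card_conj_by_fibre)
    next
      case False
      then have "{k \<in> carrier G. conj_by G k r = inv h} = {}"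
        by (auto simp del: V.conj_by_in_C_iff dest: V.conj_by_r_in_C)
      with False show ?thesis by (simp add: c_iff)
    qed
    finally have "av G sW \<rho> (\<iota> \<circ> E_V_iso G C r q \<pi> \<phi>) (f, h) =
      (if c \<in> C then sW (of_nat (card (centralizer G r)) / ?N) ?X else 0)"
      by (simp add: W.av_apply)
    moreover have "inv (conj_by G f h) = c"
      by (simp add: c_def V.inv_conj_by)
    ultimately show ?thesis
      by (simp add: W.E'_iso_apply cov_embedding_apply W.rep_scale W.rep_rep V.q_in_G)
  qed (auto simp: W.av_apply W.E'_iso_apply)
qed

text \<open>At the coordinate \<open>inv d\<close>, evaluation at \<open>q d\<close> makes one of
  the two \<open>kappa\<close> factors trivial. The other moves through \<open>\<iota>\<close> and
  combines with \<open>q d\<close> to \<open>inv f \<otimes> q (conj_by G f d)\<close>, the group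
  element produced by the coaction on the right.\<close>

lemma cov_embedding_intertwines:
  assumes \<phi>: "\<phi> \<in> coset_functions G (centralizer G r)"
  shows "id_tensor (cov_embedding G C r q sW act \<iota>) (coset_V_coaction G C r q \<pi> \<phi>) =
    group_W_coaction G act (cov_embedding G C r q sW act \<iota> \<phi>)"
proof (rule fun_eq_pairI)
  fix b :: "'g \<times> 'g" and m
  obtain f h where b: "b = (f, h)" by (cases b)
  show "id_tensor (cov_embedding G C r q sW act \<iota>) (coset_V_coaction G C r q \<pi> \<phi>) (b, m) =
    group_W_coaction G act (cov_embedding G C r q sW act \<iota> \<phi>) (b, m)"
  proof (cases "m \<in> carrier G \<and> inv m \<in> C")
    \<comment> \<open>The class is stable under conjugation, so the right-hand side vanishes at such
      \<open>m\<close> as well.\<close>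
    case False
    then show ?thesis
      unfolding b id_tensor_def split cov_embedding_apply W.group_W_coaction_apply
      by (auto simp: V.inv_conj_by)
  next
    case True
    define d where "d = inv m"
    have [simp]: "d \<in> C" "d \<in> carrier G" "m = inv d" "q d \<in> carrier G" "conj_by G (q d) r = d"
      using True by (simp_all add: d_def V.q_in_G V.conj_by_q)
    have deg: "conj_by G (q d) (inv r) = inv d"
      by (simp flip: V.inv_conj_by)
    have coaction: "coset_V_coaction G C r q \<pi> \<phi> ((f, h), q d) =
      (if f \<in> carrier G \<and> h = inv d then \<pi> (V.kappa (f \<otimes> q d)) (\<phi> (f \<otimes> q d)) else 0)"
      by (simp add: V.coset_V_coaction_apply[OF \<phi>] V.kappa_q deg)
    have "act (q d) (\<iota> (\<pi> (V.kappa (f \<otimes> q d)) (\<phi> (f \<otimes> q d)))) =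
      act (inv f \<otimes> q (conj_by G f d)) (\<iota> (\<phi> (q (conj_by G f d))))" if [simp]: "f \<in> carrier G"
    proof -
      have conj: "conj_by G (f \<otimes> q d) r = conj_by G f d"
        by (simp add: V.conj_by_mult)
      have "q (conj_by G f d) = f \<otimes> q d \<otimes> V.kappa (f \<otimes> q d)" "\<phi> (q (conj_by G f d)) = \<phi> (f \<otimes> q d)"
        using V.mult_kappa[of "f \<otimes> q d"] V.coset_function_q[OF \<phi>, of "f \<otimes> q d"] by (simp_all add: conj)
      moreover from this have "q d \<otimes> V.kappa (f \<otimes> q d) = inv f \<otimes> q (conj_by G f d)"
        by (simp add: V.m_assoc)
      ultimately show ?thesis
        by (simp add: W.rep_rep flip: act_\<iota>)
    qed
    then show ?thesis
      unfolding b id_tensor_def split cov_embedding_apply W.group_W_coaction_apply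
      by (auto simp: coaction V.inv_conj_by W.rep_scale W.rep_rep V.q_in_G)
  qed
qed

text \<open>Different class elements contribute to different basis elements \<open>inv c\<close>,
  the scalar is nonzero, and the action of \<open>q c\<close> and \<open>\<iota>\<close> are
  injective; so the values at all representatives, hence on all cosets, are recovered.\<close>

lemma inj_on_cov_embedding: "inj_on (cov_embedding G C r q sW act \<iota>) (coset_functions G (centralizer G r))"
proof (rule inj_onI)
  fix \<phi> \<psi>
  assume \<phi>: "\<phi> \<in> coset_functions G (centralizer G r)" and \<psi>: "\<psi> \<in> coset_functions G (centralizer G r)"
    and eq: "cov_embedding G C r q sW act \<iota> \<phi> = cov_embedding G C r q sW act \<iota> \<psi>"
  \<comment> \<open>The centralizer contains the identity, so both finite cardinalities are
    positive.\<close>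
  have n: "(of_nat (card (centralizer G r)) / of_nat (card (carrier G)) :: complex) \<noteq> 0"
    using V.K_closed(2) by (auto simp: card_eq_0_iff simp del: V.K_closed(2))
  have q_eq: "\<phi> (q c) = \<psi> (q c)" if "c \<in> C" for c
  proof -
    have [simp]: "c \<in> carrier G" "q c \<in> carrier G"
      using that by (simp_all add: V.C_subset V.q_in_G)
    have "act (q c) (\<iota> (\<phi> (q c))) = act (q c) (\<iota> (\<psi> (q c)))"
      using fun_cong[OF eq, of "inv c"] that n by (simp add: cov_embedding_apply)
    then have "\<iota> (\<phi> (q c)) = \<iota> (\<psi> (q c))"
      using W.rep_inv_cancel(2)[of "q c"] by (metis \<open>q c \<in> carrier G\<close>)
    then show ?thesis
      using inj_\<iota> by (simp add: inj_eq)
  qed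
  show "\<phi> = \<psi>"
  proof
    fix a
    show "\<phi> a = \<psi> a"
    proof (cases "a \<in> carrier G")
      case True
      then show ?thesis
        using q_eq[of "conj_by G a r"] by (simp add: V.coset_function_q \<phi> \<psi>)
    next
      case False
      then show ?thesis
        using \<phi> \<psi> by (simp add: V.coset_functions_iff supported_def)
    qed
  qed
qed

lemma cov_embedding: "left_comodule_embedding (dual_double G)
   sV (coset_functions G (centralizer G r)) (coset_V_coaction G C r q \<pi>)
   sW (supported (carrier G)) (group_W_coaction G act)
   (cov_embedding G C r q sW act \<iota>)"
  unfolding left_comodule_embedding_def left_comodule_hom_def
proof (intro conjI ballI allI)
  show "cov_embedding G C r q sW act \<iota> ` coset_functions G (centralizer G r) \<subseteq> supported (carrier G)"
    by (auto simp: supported_def cov_embedding_apply)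
  show "cov_embedding G C r q sW act \<iota> (\<phi> + \<psi>) =
    cov_embedding G C r q sW act \<iota> \<phi> + cov_embedding G C r q sW act \<iota> \<psi>" for \<phi> \<psi>
    by (rule ext) (simp add: cov_embedding_apply \<iota>.add W.rep_add W.scale_right_distrib V.q_in_G)
  show "cov_embedding G C r q sW act \<iota> (fscale sV a \<phi>) = fscale sW a (cov_embedding G C r q sW act \<iota> \<phi>)" for a \<phi>
    by (rule ext) (simp add: cov_embedding_apply fscale_def \<iota>.scale W.rep_scale V.q_in_G mult.commute)
qed (simp_all add: V.left_comodule_coset_V W.left_comodule_group_W cov_embedding_intertwines inj_on_cov_embedding)

end

text \<open>The composition and the formula are compared inside \<open>E'\<close>, after transport
  along the two identifications; the integral form in \<open>cov_embedding\<close> and its closed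
  form on \<open>pure_tensor\<close> are separate conjuncts.\<close>

theorem lemma3p4:
  fixes G :: "('g, 'z) monoid_scheme" (structure)
    and C :: "'g set" and r :: 'g and q :: "'g \<Rightarrow> 'g"
    and sV :: "complex \<Rightarrow> 'v \<Rightarrow> 'v::ab_group_add" and \<pi> :: "'g \<Rightarrow> 'v \<Rightarrow> 'v"
    and sW :: "complex \<Rightarrow> 'w \<Rightarrow> 'w::ab_group_add" and \<rho> :: "'w \<Rightarrow> 'g \<times> 'g \<Rightarrow> 'w"
    and act :: "'g \<Rightarrow> 'w \<Rightarrow> 'w" and gr :: "'g \<Rightarrow> 'w set"
    and \<iota> :: "'v \<Rightarrow> 'w"
  assumes "group G" and "finite (carrier G)"
    and "C \<in> conj_classes G" and "r \<in> C"
    and "\<And>c. c \<in> C \<Longrightarrow> q c \<in> carrier G"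
    and "\<And>c. c \<in> C \<Longrightarrow> q c \<otimes> r \<otimes> inv (q c) = c" and "q r = \<one>"
    and "vector_space sV" and "irreducible_representation G (centralizer G r) sV \<pi>"
    and "right_comodule (dual_double G) sW \<rho>"
    and "crossed_module G sW act gr"
    and "\<And>d w. d \<in> carrier G \<Longrightarrow> w \<in> gr d \<Longrightarrow> \<rho> w = (\<Sum>g\<in>carrier G. single (g, d) (act g w))"
    and "Vector_Spaces.linear sV sW \<iota>" and "inj \<iota>"
    and "\<And>v. H_pushout G r sW \<rho> (\<iota> v) = \<iota> \<circ> V_coaction G r \<pi> v"
  shows
    "left_comodule_iso (dual_double G)
       sV (coset_functions G (centralizer G r)) (coset_V_coaction G C r q \<pi>)
       sV (E_V G r sV \<pi>) (comult_first G sV) (E_V_iso G C r q \<pi>)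
   \<and> left_comodule_iso (dual_double G)
       sW (supported (carrier G)) (group_W_coaction G act)
       sW (E' G sW \<rho>) (comult_first G sW) (E'_iso G act)
   \<and> (\<lambda>x. \<iota> \<circ> x) ` E_V G r sV \<pi> \<subseteq> E_W G r sW \<rho>
   \<and> av G sW \<rho> ` E_W G r sW \<rho> \<subseteq> E' G sW \<rho>
   \<and> left_comodule_embedding (dual_double G)
       sV (coset_functions G (centralizer G r)) (coset_V_coaction G C r q \<pi>)
       sW (supported (carrier G)) (group_W_coaction G act)
       (cov_embedding G C r q sW act \<iota>)
   \<and> (\<forall>\<phi> \<in> coset_functions G (centralizer G r).
        av G sW \<rho> (\<iota> \<circ> E_V_iso G C r q \<pi> \<phi>) = E'_iso G act (cov_embedding G C r q sW act \<iota> \<phi>))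
   \<and> (\<forall>f \<in> coset_functions G (centralizer G r). \<forall>v.
        cov_embedding G C r q sW act \<iota> (pure_tensor sV f v) =
          fscale sW (of_nat (card (centralizer G r)) / of_nat (card (carrier G)))
            (\<Sum>c\<in>C. pure_tensor sW (single (inv c) (f (q c))) (act (q c) (\<iota> v))))"
proof -
  have rep_V: "representation G (centralizer G r) sV \<pi>"
    using assms(9) by (simp add: irreducible_representation_def)
  have rep_W: "representation G (carrier G) sW act"
    using assms(11) by (simp add: crossed_module_def)
  have vs_W: "vector_space sW"
    using assms(13) by (simp add: Vector_Spaces.linear_iff)
  interpret finite_group G
    using assms(1,2) by (simp add: finite_group_def finite_group_axioms_def)
  interpret class_section G C r q
    using assms(3-6) by unfold_locales auto
  interpret comodule_inclusion G C r q sV \<pi> sW act \<rho> gr \<iota>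
    by (intro comodule_inclusion.intro comodule_inclusion_axioms.intro induced_comodule.intro
        crossed_comodule.intro crossed_comodule_axioms.intro
        subgroup_representation.intro subgroup_representation_axioms.intro
        finite_group_axioms class_section_axioms subgroup_centralizer subgroup_self
        rep_V rep_W vs_W assms(8,10-15))
  show ?thesis
    using V.E_V_iso W.E'_iso E_V_subset_E_W W.av_in_E' cov_embedding av_E_V_iso cov_embedding_pure_tensor
    by blast
qed

end
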